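(* Let $N\ge1$ be an integer. (i) If $1\le m\le N$ is an integer, then \[ \int_0^\infty \left\{ \binom{2N-m}{N-m}\operatorname{sech} x - \sum_{j=m}^{N}\binom{2N-j-1}{N-j}\operatorname{sech}^j x \right\}\frac{dx}{x^2} = \sum_{j=m}^{N}\binom{2N-j-1}{N-j}\mathcal F_j . \] (ii) With $C_N=\frac{1}{N+1}\binom{2N}{N}$ the $N$th Catalan number, \[ \int_0^\infty \left\{ C_N\operatorname{sech} x - \sum_{j=1}^{N} \frac{j}{N} \binom{2N-j-1}{N-1}\operatorname{sech}^j x \right\}\frac{dx}{x^2} = \sum_{j=1}^{N} \frac{j}{N} \binom{2N-j-1}{N-1}\mathcal F_j . \]
   Context: The signed generalized Stirling polynomials $P_k(m,x)$, $0\le k\le m$, are defined by the polynomial identity in an indeterminate $y$: $\prod_{i=1}^{m}(y+i-x)=\sum_{k=0}^{m}(-1)^kP_k(m,x)\,y^{m-k}$. Let $\zeta(s,a)$ be the Hurwitz zeta function (meromorphically continued in $s$), $\zeta'(s,a)=\partial_s\zeta(s,a)$, and $G=\sum_{k\ge0}(-1)^k/(2k+1)^2$ Catalan's constant. Define $\mathcal F_1=0$ and, for integers $j\ge2$, \[ \begin{aligned} \mathcal F_j={}&-\frac{4G}{\pi} +\frac{2^{2j-3}j^2}{(j-1)!} \sum_{m=0}^{j-1}\left(-\tfrac12\right)^m P_m\!\left(j-1,\tfrac{j}{2}\right) \left[\zeta'\!\left(m-j+2,\tfrac{j}{4}\right)-\zeta'\!\left(m-j+2,\tfrac{j+2}{4}\right)\right]\\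 &-\frac{2^{2j+1}}{(j-1)!} \sum_{m=0}^{j+1}\left(-\tfrac12\right)^m P_m\!\left(j+1,\tfrac{j+2}{2}\right) \left[\zeta'\!\left(m-j,\tfrac{j+2}{4}\right)-\zeta'\!\left(m-j,\tfrac{j+4}{4}\right)\right], \end{aligned} \] where any bracket whose first argument equals $1$ is interpreted as the finite limit $\lim_{s\to1}[\zeta'(s,a)-\zeta'(s,b)]$ (equal to $-\gamma_1(a)+\gamma_1(b)$ in terms of generalized Stieltjes constants). *)

theory Defs
  imports
    "HOL-Complex_Analysis.Complex_Analysis"
    "HOL-Computational_Algebra.Polynomial"
begin

definition sech :: "real \<Rightarrow> real" where
  "sech x = 1 / cosh x"

definition catalan_const :: real where
  "catalan_const = (\<Sum>k. (-1) ^ k / (2 * real k + 1)\<^sup>2)"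

text \<open>
  \<open>gen_stirling k m x\<close> is \<open>P\<^sub>k(m,x)\<close>, obtained by reading off the coefficient of \<open>y\<^bsup>m-k\<^esup>\<close>;
  the polynomial variable plays the role of the indeterminate \<open>y\<close>.
\<close>

definition gen_stirling :: "nat \<Rightarrow> nat \<Rightarrow> 'a \<Rightarrow> 'a :: comm_ring_1" where
  "gen_stirling k m x = (-1) ^ k * coeff (\<Prod>i=1..m. [:of_nat i - x, 1:]) (m - k)"

lemma gen_stirling_identity:
  fixes x :: "'a :: comm_ring_1"
  shows "(\<Prod>i=1..m. [:of_nat i - x, 1:]) = (\<Sum>k\<le>m. monom ((-1) ^ k * gen_stirling k m x) (m - k))"
proof -
  let ?p = "\<Prod>i=1..m. [:of_nat i - x, 1:]"
  have "degree ?p \<le> (\<Sum>i=1..m. degree [:of_nat i - x, 1:])"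
    using degree_prod_sum_le[of "{1..m}" "\<lambda>i. [:of_nat i - x, 1:]"] by (simp add: o_def)
  also have "\<dots> = m" by simp
  finally have "degree ?p \<le> m" .
  then have "?p = (\<Sum>k\<le>m. monom (coeff ?p k) k)"
    by (rule poly_as_sum_of_monoms'[symmetric])
  also have "\<dots> = (\<Sum>k\<le>m. monom (coeff ?p (m - k)) (m - k))"
    by (rule sum.reindex_bij_witness[of _ "\<lambda>k. m - k" "\<lambda>k. m - k"]) auto
  also have "\<dots> = (\<Sum>k\<le>m. monom ((-1) ^ k * gen_stirling k m x) (m - k))"
  proof (intro sum.cong refl)
    fix k
    have "(-1) ^ k * ((-1) ^ k * c) = c" for c :: 'a
      by (induction k) auto
    then show "monom (coeff ?p (m - k)) (m - k) = monom ((-1) ^ k * gen_stirling k m x) (m - k)"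
      unfolding gen_stirling_def by presburger
  qed
  finally show ?thesis .
qed

text \<open>
  For \<open>a > 0\<close>, the meromorphic function on the whole plane that agrees with the Hurwitz series on
  \<open>Re s > 1\<close>. Since \<open>nicely_meromorphic_on\<close> forces removable singularities to be removed and the
  value at a pole to be \<open>0\<close>, this determines the function everywhere, with junk value \<open>0\<close> at its
  only pole \<open>s = 1\<close>.
\<close>

definition hurwitz_zeta :: "complex \<Rightarrow> real \<Rightarrow> complex" where
  "hurwitz_zeta s a =
     (THE f. f nicely_meromorphic_on UNIV \<and>
             (\<forall>z. Re z > 1 \<longrightarrow> f z = (\<Sum>n. of_real (real n + a) powr (-z)))) s"

definition hurwitz_zeta_deriv :: "complex \<Rightarrow> real \<Rightarrow> complex" where
  "hurwitz_zeta_deriv s a = deriv (\<lambda>z. hurwitz_zeta z a) s"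

definition zeta_bracket :: "complex \<Rightarrow> real \<Rightarrow> real \<Rightarrow> complex" where
  "zeta_bracket s a b =
     (if s = 1 then Lim (at 1) (\<lambda>z. hurwitz_zeta_deriv z a - hurwitz_zeta_deriv z b)
      else hurwitz_zeta_deriv s a - hurwitz_zeta_deriv s b)"

text \<open>
  The definition is meant for \<open>j \<ge> 1\<close>. The values are real, but they are kept in \<^typ>\<open>complex\<close>
  because the zeta function is.
\<close>

definition sech_F :: "nat \<Rightarrow> complex" where
  "sech_F j =
     (if j \<le> 1 then 0 else
        - of_real (4 * catalan_const / pi)
        + 2 ^ (2 * j - 3) * of_nat j ^ 2 / fact (j - 1) *
          (\<Sum>m=0..j-1. (-1/2) ^ m * gen_stirling m (j - 1) (of_nat j / 2) *
             zeta_bracket (of_nat m - of_nat j + 2) (real j / 4) ((real j + 2) / 4))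
        - 2 ^ (2 * j + 1) / fact (j - 1) *
          (\<Sum>m=0..j+1. (-1/2) ^ m * gen_stirling m (j + 1) ((of_nat j + 2) / 2) *
             zeta_bracket (of_nat m - of_nat j) ((real j + 2) / 4) ((real j + 4) / 4)))"

end

theory Submission
  imports Defs "HOL-Probability.Sinc_Integral" "HOL-Real_Asymp.Real_Asymp"
begin

text \<open>
  By linearity and two binomial identities it suffices that \<open>\<F>\<^sub>j\<close> is the integral of
  \<open>(sech x - sech\<^sup>j x) / x\<^sup>2\<close>. For \<open>F\<close> even and exponentially decaying, \<open>\<integral>(F 0 - F x) / x\<^sup>2 dx\<close> is the
  derivative at \<open>s = -1\<close> of the entire function \<open>N s = (\<integral>x\<^bsup>s-1\<^esup> F x dx) / \<Gamma>(s)\<close>, which vanishes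
  there. Differentiating \<open>F\<close> shifts the argument of \<open>N\<close> by one, so for \<open>F = sech\<^sup>j\<close> the equation
  \<open>F'' = j\<^sup>2 sech\<^sup>j - j (j + 1) sech\<^bsup>j+2\<^esup>\<close> moves this point to \<open>s = 1\<close>. Expanding \<open>sech\<^sup>j\<close> in powers
  of \<open>e\<^bsup>-2x\<^esup>\<close> expresses its transform as \<open>4\<^bsup>-s\<^esup>\<close> times a combination of differences of Hurwitz zeta
  functions. As the total vanishes at \<open>s = 1\<close>, the derivative of \<open>4\<^bsup>-s\<^esup>\<close> drops out and only the
  zeta brackets remain. Finally \<open>\<integral>(1 - sech x) / x\<^sup>2 dx = 4G / \<pi>\<close> by integrating the partial
  fraction expansion of \<open>sech\<close> termwise.
\<close>

subsection \<open>Series and derivatives under the integral sign\<close>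

lemma has_bochner_integral_sums:
  fixes f :: "nat \<Rightarrow> 'a \<Rightarrow> 'b :: {banach, second_countable_topology}"
  assumes f_integral: "\<And>n. has_bochner_integral M (f n) (I n)"
    and norm_f_integral: "\<And>n. has_bochner_integral M (\<lambda>x. norm (f n x)) (J n)"
    and J_summable: "summable J"
    and g_sums: "\<And>x. x \<in> space M \<Longrightarrow> (\<lambda>n. f n x) sums g x"
  shows "summable I" and "has_bochner_integral M g (suminf I)"
proof -
  have J_nonneg: "J n \<ge> 0" for n
    using norm_f_integral[of n] Bochner_Integration.integral_nonneg[of M "\<lambda>x. norm (f n x)"]
    by (simp add: has_bochner_integral_iff)
  have [measurable]: "f n \<in> borel_measurable M" for n
    using f_integral[of n] by (auto simp: has_bochner_integral_iff)
  have "(\<integral>\<^sup>+x. ennreal (norm (f n x)) \<partial>M) = ennreal (J n)" for n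
    using norm_f_integral[of n]
    by (subst nn_integral_eq_integral) (auto simp: has_bochner_integral_iff)
  then have "(\<integral>\<^sup>+x. (\<Sum>n. ennreal (norm (f n x))) \<partial>M) = ennreal (suminf J)"
    using J_nonneg J_summable
    by (subst nn_integral_suminf) (auto simp: suminf_ennreal_eq summable_sums)
  then have "AE x in M. (\<Sum>n. ennreal (norm (f n x))) \<noteq> \<infinity>"
    by (intro nn_integral_PInf_AE) auto
  then have norm_summable: "AE x in M. summable (\<lambda>n. norm (f n x))"
    by eventually_elim (auto intro: summable_suminf_not_top)
  have norm_integral_summable: "summable (\<lambda>n. \<integral>x. norm (f n x) \<partial>M)"
    using J_summable norm_f_integral by (simp add: has_bochner_integral_iff)
  have f_integrable: "integrable M (f n)" for n
    using f_integral[of n] by (simp add: has_bochner_integral_iff)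
  note termwise = f_integrable norm_summable norm_integral_summable
  have suminf_f: "(\<Sum>n. f n x) = g x" if "x \<in> space M" for x
    using g_sums[OF that] by (simp add: sums_iff)
  have I_eq: "I = (\<lambda>n. integral\<^sup>L M (f n))"
    using f_integral by (auto simp: has_bochner_integral_iff)
  show "summable I"
    unfolding I_eq by (rule summable_integral[OF termwise])
  have "has_bochner_integral M (\<lambda>x. \<Sum>n. f n x) (suminf I)"
    unfolding has_bochner_integral_iff I_eq using termwise
    by (intro conjI integrable_suminf integral_suminf)
  then show "has_bochner_integral M g (suminf I)"
    by (subst (asm) has_bochner_integral_cong[OF refl suminf_f refl])
qed

lemma has_field_derivative_integral:
  fixes f :: "'b \<Rightarrow> 'a \<Rightarrow> 'b :: {real_normed_field, banach, second_countable_topology}"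
  assumes U_nhd: "open U" "s \<in> U"
    and f_integrable: "\<And>z. z \<in> U \<Longrightarrow> integrable M (f z)"
    and f'_deriv: "f' \<in> borel_measurable M"
      "\<And>x. x \<in> space M \<Longrightarrow> ((\<lambda>z. f z x) has_field_derivative f' x) (at s)"
    and f_Lipschitz: "integrable M w"
      "\<And>z x. z \<in> U \<Longrightarrow> x \<in> space M \<Longrightarrow> norm (f z x - f s x) \<le> norm (z - s) * w x"
  shows "((\<lambda>z. \<integral>x. f z x \<partial>M) has_field_derivative (\<integral>x. f' x \<partial>M)) (at s)"
  unfolding has_field_derivative_iff tendsto_at_iff_sequentially
proof (intro allI impI)
  fix X assume X_tendsto: "\<forall>n. X n \<in> UNIV - {s}" "X \<longlonglongrightarrow> s"
  define q where "q = (\<lambda>z x. (f z x - f s x) / (z - s))"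
  obtain N where X_in_U: "X (n + N) \<in> U" for n
    using topological_tendstoD[OF X_tendsto(2) U_nhd] unfolding eventually_sequentially
    by (metis le_add2)
  have X_at: "filterlim (\<lambda>n. X (n + N)) (at s) sequentially"
    using X_tendsto by (intro filterlim_atI LIMSEQ_ignore_initial_segment) auto
  have "(\<lambda>n. integral\<^sup>L M (q (X (n + N)))) \<longlonglongrightarrow> integral\<^sup>L M f'"
  proof (rule integral_dominated_convergence[OF f'_deriv(1) _ f_Lipschitz(1)])
    show "q (X (n + N)) \<in> borel_measurable M" for n
      unfolding q_def using f_integrable[OF X_in_U[of n]] f_integrable[OF U_nhd(2)] by measurable
    show "AE x in M. (\<lambda>n. q (X (n + N)) x) \<longlonglongrightarrow> f' x"
      using f'_deriv(2) unfolding q_def has_field_derivative_iff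
      by (intro AE_I2 filterlim_compose[OF _ X_at]) blast
    show "AE x in M. norm (q (X (n + N)) x) \<le> w x" for n
      using f_Lipschitz(2)[OF X_in_U[of n]] X_tendsto(1)
      by (intro AE_I2) (simp add: q_def norm_divide divide_le_eq mult.commute)
  qed
  moreover have "integral\<^sup>L M (q z) = (integral\<^sup>L M (f z) - integral\<^sup>L M (f s)) / (z - s)"
    if "z \<in> U" for z
    unfolding q_def using f_integrable[OF that] f_integrable[OF U_nhd(2)] by simp
  ultimately have "(\<lambda>n. (integral\<^sup>L M (f (X (n + N))) - integral\<^sup>L M (f s)) / (X (n + N) - s))
      \<longlonglongrightarrow> integral\<^sup>L M f'"
    using X_in_U by simp
  then show "((\<lambda>z. (integral\<^sup>L M (f z) - integral\<^sup>L M (f s)) / (z - s)) \<circ> X)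
      \<longlonglongrightarrow> integral\<^sup>L M f'"
    unfolding o_def by (rule LIMSEQ_offset)
qed

subsection \<open>Integration over the half-line\<close>

abbreviation (input) halfline :: "real measure" where
  "halfline \<equiv> restrict_space lborel {0<..}"

lemma space_halfline [simp]: "space halfline = {0<..}"
  by (simp add: space_restrict_space)

lemma borel_measurable_halfline:
  fixes f :: "real \<Rightarrow> 'a :: topological_space"
  assumes "continuous_on {0<..} f"
  shows "f \<in> borel_measurable halfline"
  using borel_measurable_continuous_on_restrict[OF assms]
  by (simp cong: measurable_cong_sets sets_restrict_space_cong)

lemma has_bochner_integral_halfline_iff:
  fixes f :: "real \<Rightarrow> 'a :: {banach, second_countable_topology}"
  shows "has_bochner_integral halfline f I \<longleftrightarrow>
         has_bochner_integral lborel (\<lambda>x. indicator {0<..} x *\<^sub>R f x) I"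
  by (simp add: has_bochner_integral_iff integrable_restrict_space integral_restrict_space)

lemma has_bochner_integral_halfline_iff_interval:
  fixes f :: "real \<Rightarrow> 'a :: {banach, second_countable_topology}"
  shows "has_bochner_integral halfline f I \<longleftrightarrow>
         interval_lebesgue_integrable lborel 0 \<infinity> f \<and> (LBINT x=0..\<infinity>. f x) = I"
proof -
  have "einterval 0 \<infinity> = {0<..}"
    by (auto simp: einterval_def)
  then show ?thesis
    by (simp add: has_bochner_integral_iff integrable_restrict_space integral_restrict_space
        interval_lebesgue_integrable_def interval_lebesgue_integral_def
        set_integrable_def set_lebesgue_integral_def)
qed

lemma has_bochner_integral_halfline_scale:
  fixes f :: "real \<Rightarrow> 'a :: {banach, second_countable_topology}"
  assumes f_integral: "has_bochner_integral halfline f I" and c_pos: "c > 0"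
  shows "has_bochner_integral halfline (\<lambda>x. f (c * x)) (I /\<^sub>R c)"
proof -
  have "has_bochner_integral lborel
          (\<lambda>x. indicator {0<..} (0 + c * x) *\<^sub>R f (0 + c * x)) (I /\<^sub>R \<bar>c\<bar>)"
    using f_integral c_pos unfolding has_bochner_integral_halfline_iff
    by (subst (asm) lborel_has_bochner_integral_real_affine_iff[of c _ _ 0]) auto
  moreover have "indicator {0<..} (c * x) = (indicator {0<..} x :: real)" for x
    using c_pos by (auto simp: indicator_def zero_less_mult_iff)
  ultimately show ?thesis
    using c_pos by (simp add: has_bochner_integral_halfline_iff)
qed

lemma integral_halfline_FTC:
  fixes f F :: "real \<Rightarrow> 'a :: euclidean_space"
  assumes F_deriv: "\<And>x. x > 0 \<Longrightarrow> (F has_vector_derivative f x) (at x)"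
    and f_cont_integrable: "continuous_on {0<..} f" "integrable halfline f"
    and limits: "(F \<longlongrightarrow> a) (at_right 0)" "(F \<longlongrightarrow> b) at_top"
  shows "integral\<^sup>L halfline f = b - a"
proof -
  have f_interval: "interval_lebesgue_integrable lborel 0 \<infinity> f"
    "(LBINT x=0..\<infinity>. f x) = integral\<^sup>L halfline f"
    using has_bochner_integral_halfline_iff_interval[of f]
        has_bochner_integral_integrable[OF f_cont_integrable(2)]
    by blast+
  have "(LBINT x=0..\<infinity>. f x) = b - a"
  proof (rule interval_integral_FTC_integrable)
    show "set_integrable lborel (einterval 0 \<infinity>) f"
      using f_interval(1) by (simp add: interval_lebesgue_integrable_def)
    show "((F \<circ> real_of_ereal) \<longlongrightarrow> a) (at_right 0)" "((F \<circ> real_of_ereal) \<longlongrightarrow> b) (at_left \<infinity>)"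
      using limits by (auto simp: ereal_tendsto_simps zero_ereal_def)
    show "isCont f x" if "0 < ereal x" "ereal x < \<infinity>" for x
      using f_cont_integrable(1) that by (auto simp: continuous_on_eq_continuous_at)
  qed (use F_deriv in auto)
  then show ?thesis
    using f_interval(2) by simp
qed

lemma has_bochner_integral_inverse_square_plus_square:
  assumes a_pos: "a > 0"
  shows "has_bochner_integral halfline (\<lambda>x. 1 / (a\<^sup>2 + x\<^sup>2)) (pi / (2 * a))"
proof -
  have "has_bochner_integral halfline (\<lambda>x. 1 / (1 + x\<^sup>2)) (pi / 2)"
    using integrable_I0i_1_div_plus_square LBINT_I0i_1_div_plus_square
    by (simp add: has_bochner_integral_halfline_iff_interval)
  then have "has_bochner_integral halfline (\<lambda>x. 1 / (1 + (1 / a * x)\<^sup>2)) (pi / 2 /\<^sub>R (1 / a))"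
    using a_pos by (intro has_bochner_integral_halfline_scale[where f = "\<lambda>x. 1 / (1 + x\<^sup>2)"]) auto
  then have "has_bochner_integral halfline (\<lambda>x. 1 / a\<^sup>2 * (1 / (1 + (1 / a * x)\<^sup>2)))
               (1 / a\<^sup>2 * (pi / 2 /\<^sub>R (1 / a)))"
    by (rule has_bochner_integral_mult_right)
  moreover have "1 / a\<^sup>2 * (1 / (1 + (1 / a * x)\<^sup>2)) = 1 / (a\<^sup>2 + x\<^sup>2)" for x
  proof -
    have "a\<^sup>2 * (1 + (1 / a * x)\<^sup>2) = a\<^sup>2 + x\<^sup>2"
      using a_pos by (simp add: power_divide distrib_left)
    then show ?thesis
      by (metis divide_divide_eq_left divide_self_if mult_1 times_divide_times_eq)
  qed
  moreover have "1 / a\<^sup>2 * (pi / 2 /\<^sub>R (1 / a)) = pi / (2 * a)"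
    using a_pos by (simp add: power2_eq_square)
  ultimately show ?thesis
    by (simp only:)
qed

lemma has_bochner_integral_Gamma_integral:
  assumes Re_s: "Re s > 0"
  shows "has_bochner_integral halfline
           (\<lambda>x. of_real x powr (s - 1) / of_real (exp x)) (Gamma s)"
proof -
  let ?f = "\<lambda>x. complex_of_real x powr (s - 1) / of_real (exp x)"
  let ?g = "\<lambda>x. indicator {0<..} x *\<^sub>R ?f x"
  have "?f \<in> borel_measurable halfline"
    by (intro borel_measurable_halfline continuous_intros) auto
  then have [measurable]: "?g \<in> borel_measurable lborel"
    by (subst (asm) borel_measurable_restrict_space_iff) auto
  have abs_int: "set_integrable lebesgue {0<..} ?f"
    by (rule absolutely_integrable_Gamma_integral'[OF Re_s])
  then have "(?f has_integral integral\<^sup>L lebesgue ?g) {0<..}"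
    using has_integral_set_lebesgue[OF abs_int] by (simp add: set_lebesgue_integral_def)
  then have "integral\<^sup>L lebesgue ?g = Gamma s"
    using Gamma_integral_complex'[OF Re_s] has_integral_unique by blast
  then have "has_bochner_integral lborel ?g (Gamma s)"
    using abs_int
    by (auto simp: has_bochner_integral_iff set_integrable_def integrable_completion
        integral_completion)
  then show ?thesis
    by (simp add: has_bochner_integral_halfline_iff)
qed

lemma has_bochner_integral_Gamma:
  assumes Re_s: "Re s > 0" and c_pos: "c > 0"
  shows "has_bochner_integral halfline
           (\<lambda>x. of_real x powr (s - 1) * of_real (exp (- (c * x)))) (Gamma s / of_real c powr s)"
proof -
  have "has_bochner_integral halfline
          (\<lambda>x. of_real c powr (1 - s) * (of_real (c * x) powr (s - 1) / of_real (exp (c * x))))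
          (of_real c powr (1 - s) * (Gamma s /\<^sub>R c))"
    using has_bochner_integral_halfline_scale[OF has_bochner_integral_Gamma_integral[OF Re_s] c_pos]
    by (rule has_bochner_integral_mult_right)
  also have "of_real c powr (1 - s) * (Gamma s /\<^sub>R c) = Gamma s / of_real c powr s"
    using c_pos by (simp add: powr_diff scaleR_conv_of_real field_simps)
  finally show ?thesis
  proof (rule has_bochner_integral_cong[THEN iffD1, rotated 3])
    fix x assume "x \<in> space halfline"
    then have "x > 0" by simp
    then have
      "complex_of_real (c * x) powr (s - 1) = of_real c powr (s - 1) * of_real x powr (s - 1)"
      using c_pos by (simp add: powr_times_real)
    moreover have "complex_of_real c powr (1 - s) * of_real c powr (s - 1) = 1"
      using c_pos by (simp flip: powr_add)
    ultimately show "complex_of_real c powr (1 - s) *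
        (of_real (c * x) powr (s - 1) / of_real (exp (c * x))) =
        of_real x powr (s - 1) * of_real (exp (- (c * x)))"
      by (simp add: exp_minus field_simps exp_of_real)
  qed auto
qed

lemma has_bochner_integral_Gamma_real:
  assumes "s > 0" "c > 0"
  shows "has_bochner_integral halfline (\<lambda>x. x powr (s - 1) * exp (- (c * x))) (Gamma s / c powr s)"
proof -
  have "has_bochner_integral halfline
           (\<lambda>x. Re (of_real x powr (of_real s - 1) * of_real (exp (- (c * x)))))
           (Re (Gamma (of_real s) / of_real c powr of_real s))"
    using has_bochner_integral_Gamma[of "of_real s" c] assms
    by (intro has_bochner_integral_Re) auto
  also have "Re (Gamma (of_real s) / of_real c powr of_real s) = Gamma s / c powr s"
    using assms by (simp add: powr_of_real Gamma_complex_of_real Re_divide_of_real)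
  finally show ?thesis
    by (rule has_bochner_integral_cong[THEN iffD1, rotated 3])
       (auto simp: powr_of_real powr_Reals_eq)
qed

subsection \<open>Mellin transforms\<close>

definition exp_decay :: "(real \<Rightarrow> complex) \<Rightarrow> bool" where
  "exp_decay g \<longleftrightarrow> continuous_on {0<..} g \<and> (\<exists>C c. c > 0 \<and> (\<forall>x>0. norm (g x) \<le> C * exp (- (c * x))))"

definition mellin :: "(real \<Rightarrow> complex) \<Rightarrow> complex \<Rightarrow> complex" where
  "mellin g s = (\<integral>x. of_real x powr (s - 1) * g x \<partial>halfline)"

lemma exp_decay_bounded:
  assumes "exp_decay g"
  obtains B where "\<And>x. x > 0 \<Longrightarrow> norm (g x) \<le> B"
proof -
  obtain C c where c_pos: "c > 0" and g_bound: "\<And>x. x > 0 \<Longrightarrow> norm (g x) \<le> C * exp (- (c * x))"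
    using assms by (auto simp: exp_decay_def)
  show thesis
  proof
    fix x :: real assume x_pos: "x > 0"
    then have "norm (g x) \<le> C * exp (- (c * x))"
      by (rule g_bound)
    also have "\<dots> \<le> \<bar>C\<bar> * 1"
      using c_pos x_pos by (intro mult_mono) auto
    finally show "norm (g x) \<le> \<bar>C\<bar>"
      by simp
  qed
qed

lemma mellin_cong: "(\<And>x. x > 0 \<Longrightarrow> f x = g x) \<Longrightarrow> mellin f s = mellin g s"
  unfolding mellin_def by (rule Bochner_Integration.integral_cong) auto

lemma mellin_times_ident: "mellin (\<lambda>x. of_real x * g x) s = mellin g (s + 1)"
  unfolding mellin_def
proof (rule Bochner_Integration.integral_cong[OF refl])
  fix x assume "x \<in> space halfline"
  then have "complex_of_real x powr (s + 1 - 1) = of_real x powr (s - 1) * of_real x"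
    using powr_add[of "complex_of_real x" "s - 1" 1] by simp
  then show "of_real x powr (s - 1) * (of_real x * g x) = of_real x powr (s + 1 - 1) * g x"
    by (simp add: mult.assoc)
qed

lemma integrable_mellin:
  assumes g_decay: "exp_decay g" and Re_s: "Re s > 0"
  shows "integrable halfline (\<lambda>x. of_real x powr (s - 1) * g x)"
proof -
  obtain C c where c_pos: "c > 0" and g_bound: "\<And>x. x > 0 \<Longrightarrow> norm (g x) \<le> C * exp (- (c * x))"
    and g_cont: "continuous_on {0<..} g"
    using g_decay by (auto simp: exp_decay_def)
  show ?thesis
  proof (rule Bochner_Integration.integrable_bound)
    show "integrable halfline (\<lambda>x. C * (x powr (Re s - 1) * exp (- (c * x))))"
      using has_bochner_integral_Gamma_real[OF Re_s c_pos]
      by (intro integrable_mult_right) (simp add: has_bochner_integral_iff)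
    show "(\<lambda>x. of_real x powr (s - 1) * g x) \<in> borel_measurable halfline"
      by (intro borel_measurable_halfline continuous_intros g_cont) auto
    have "norm (of_real x powr (s - 1) * g x) \<le> norm (C * (x powr (Re s - 1) * exp (- (c * x))))"
      if x_pos: "x > 0" for x
    proof -
      have "norm (of_real x powr (s - 1) * g x) = x powr (Re s - 1) * norm (g x)"
        using x_pos by (simp add: norm_mult norm_powr_real_powr)
      also have "\<dots> \<le> x powr (Re s - 1) * (C * exp (- (c * x)))"
        by (intro mult_left_mono g_bound x_pos) auto
      also have "\<dots> = C * (x powr (Re s - 1) * exp (- (c * x)))"
        by (simp only: mult_ac)
      also have "\<dots> \<le> norm \<dots>"
        by simp
      finally show ?thesis .
    qed
    then show "AE x in halfline. norm (of_real x powr (s - 1) * g x)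
            \<le> norm (C * (x powr (Re s - 1) * exp (- (c * x))))"
      by (intro AE_I2) simp
  qed
qed

lemma mellin_1: "mellin g 1 = integral\<^sup>L halfline g"
  unfolding mellin_def by (rule Bochner_Integration.integral_cong) auto

lemma integrable_exp_decay:
  assumes "exp_decay g"
  shows "integrable halfline g"
proof -
  have "integrable halfline (\<lambda>x. of_real x powr (1 - 1) * g x)"
    using assms by (rule integrable_mellin) simp
  then show ?thesis
    by (subst (asm) Bochner_Integration.integrable_cong[of _ _ _ g]) auto
qed

lemma mellin_linear:
  assumes "exp_decay f" "exp_decay g" "Re s > 0"
  shows "mellin (\<lambda>x. a * f x + b * g x) s = a * mellin f s + b * mellin g s"
proof -
  have "mellin (\<lambda>x. a * f x + b * g x) s =
        (\<integral>x. a * (of_real x powr (s - 1) * f x) + b * (of_real x powr (s - 1) * g x) \<partial>halfline)"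
    by (simp add: mellin_def algebra_simps)
  also have "\<dots> = a * mellin f s + b * mellin g s"
    using integrable_mellin[OF assms(1,3)] integrable_mellin[OF assms(2,3)]
    by (simp add: mellin_def)
  finally show ?thesis .
qed

lemma norm_exp_minus_one_le:
  fixes z :: complex
  shows "norm (exp z - 1) \<le> norm z * exp (norm z)"
proof -
  have "norm (exp z - exp 0) \<le> exp (norm z) * norm (z - 0)"
  proof (rule field_differentiable_bound[of "cball 0 (norm z)"])
    show "norm (exp w) \<le> exp (norm z)" if "w \<in> cball 0 (norm z)" for w :: complex
      using that norm_exp[of w] by (auto intro: order_trans)
  qed (auto intro!: derivative_eq_intros)
  then show ?thesis by (simp add: mult.commute)
qed

lemma norm_powr_minus_one_le:
  fixes w :: complex
  assumes x_pos: "x > 0" and \<delta>_bounds: "\<delta> > 0" "norm w \<le> \<delta>"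
  shows "norm (of_real x powr w - 1) \<le> norm w * ((x powr (2 * \<delta>) + x powr (- (2 * \<delta>))) / \<delta>)"
proof -
  define l where "l = \<bar>ln x\<bar>"
  have "of_real x powr w = exp (w * of_real (ln x))"
    using x_pos by (simp add: powr_def Ln_of_real)
  then have "norm (of_real x powr w - 1) \<le> norm w * (l * exp (norm w * l))"
    using norm_exp_minus_one_le[of "w * of_real (ln x)"] by (simp add: norm_mult l_def mult.assoc)
  also have "l * exp (norm w * l) \<le> exp (\<delta> * l) / \<delta> * exp (\<delta> * l)"
  proof (rule mult_mono)
    have "\<delta> * l \<le> exp (\<delta> * l)"
      using exp_ge_add_one_self[of "\<delta> * l"] by linarith
    then show "l \<le> exp (\<delta> * l) / \<delta>"
      using \<delta>_bounds by (simp add: field_simps)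
  qed (use \<delta>_bounds in \<open>auto simp: l_def intro!: mult_right_mono\<close>)
  also have "\<dots> = exp (2 * \<delta> * l) / \<delta>"
    by (simp flip: exp_add)
  also have "exp (2 * \<delta> * l) \<le> x powr (2 * \<delta>) + x powr (- (2 * \<delta>))"
    using x_pos by (auto simp: powr_def l_def abs_if intro: add_increasing add_increasing2)
  finally show ?thesis
    using \<delta>_bounds by (simp add: divide_right_mono mult_left_mono)
qed

lemma norm_powr_diff_le:
  fixes s z :: complex
  assumes x_pos: "x > 0" and \<delta>_bounds: "\<delta> > 0" "norm (z - s) \<le> \<delta>"
  shows "norm (of_real x powr z - of_real x powr s) \<le>
           norm (z - s) * ((x powr (Re s + 2 * \<delta>) + x powr (Re s - 2 * \<delta>)) / \<delta>)"
proof -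
  have "of_real x powr z - of_real x powr s = of_real x powr s * (of_real x powr (z - s) - 1)"
    using powr_add[of "complex_of_real x" s "z - s"] by (simp add: algebra_simps)
  also have "norm \<dots> \<le> x powr Re s * (norm (z - s) * ((x powr (2 * \<delta>) + x powr (- (2 * \<delta>))) / \<delta>))"
    unfolding norm_mult using x_pos \<delta>_bounds
    by (intro mult_mono norm_powr_minus_one_le) (auto simp: norm_powr_real_powr)
  also have "\<dots> = norm (z - s) * ((x powr (Re s + 2 * \<delta>) + x powr (Re s - 2 * \<delta>)) / \<delta>)"
    using \<delta>_bounds(1) by (simp add: powr_add powr_diff powr_minus field_simps)
  finally show ?thesis .
qed

lemma mellin_field_differentiable:
  assumes g_decay: "exp_decay g" and Re_s: "Re s > 0"
  shows "mellin g field_differentiable (at s)"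
proof -
  define \<delta> where "\<delta> = Re s / 4"
  have \<delta>_pos: "\<delta> > 0" using Re_s by (simp add: \<delta>_def)
  define w where "w = (\<lambda>x. (norm (of_real x powr (s + of_real (2 * \<delta>) - 1) * g x) +
                           norm (of_real x powr (s - of_real (2 * \<delta>) - 1) * g x)) / \<delta>)"
  have Re_pos_ball: "Re z > 0" if "z \<in> ball s \<delta>" for z
    using that abs_Re_le_cmod[of "s - z"] Re_s by (auto simp: dist_norm \<delta>_def)
  have "((\<lambda>z. \<integral>x. of_real x powr (z - 1) * g x \<partial>halfline) has_field_derivative
          (\<integral>x. of_real (ln x) * (of_real x powr (s - 1) * g x) \<partial>halfline)) (at s)"
  proof (rule has_field_derivative_integral[where U = "ball s \<delta>" and w = w])
    show "integrable halfline (\<lambda>x. of_real x powr (z - 1) * g x)" if "z \<in> ball s \<delta>" for z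
      by (rule integrable_mellin[OF g_decay Re_pos_ball[OF that]])
    have "continuous_on {0<..} g"
      using g_decay by (simp add: exp_decay_def)
    then show "(\<lambda>x. of_real (ln x) * (of_real x powr (s - 1) * g x)) \<in> borel_measurable halfline"
      by (intro borel_measurable_halfline continuous_intros) auto
    show "((\<lambda>z. of_real x powr (z - 1) * g x) has_field_derivative
            of_real (ln x) * (of_real x powr (s - 1) * g x)) (at s)" if "x \<in> space halfline" for x
      using that by (auto simp: powr_def Ln_of_real intro!: derivative_eq_intros)
    show "integrable halfline w"
      unfolding w_def using Re_s
      by (intro integrable_divide Bochner_Integration.integrable_add integrable_norm
          integrable_mellin g_decay) (auto simp: \<delta>_def)
    fix z x assume z_ball: "z \<in> ball s \<delta>" and x_pos: "x \<in> space halfline"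
    have "norm (of_real x powr (z - 1) - of_real x powr (s - 1)) * norm (g x) \<le>
        norm (z - s) * ((x powr (Re s - 1 + 2 * \<delta>) + x powr (Re s - 1 - 2 * \<delta>)) / \<delta>) * norm (g x)"
      using norm_powr_diff_le[of x \<delta> "z - 1" "s - 1"] z_ball x_pos \<delta>_pos
      by (intro mult_right_mono) (auto simp: dist_norm norm_minus_commute)
    also have "\<dots> = norm (z - s) * w x"
      using x_pos
      by (simp add: w_def norm_mult norm_powr_real_powr algebra_simps add_divide_distrib)
    finally show
      "norm (of_real x powr (z - 1) * g x - of_real x powr (s - 1) * g x) \<le> norm (z - s) * w x"
      by (simp flip: left_diff_distrib add: norm_mult)
  qed (use \<delta>_pos in auto)
  then show ?thesis
    by (auto simp: field_differentiable_def mellin_def[abs_def])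
qed

lemma mellin_holomorphic: "exp_decay g \<Longrightarrow> mellin g holomorphic_on {s. Re s > 0}"
  by (auto simp: holomorphic_on_def intro: field_differentiable_at_within mellin_field_differentiable)

lemma exp_decay_powr_tendsto_0:
  assumes g_decay: "exp_decay g" and Re_s: "Re s > 0"
  shows "((\<lambda>x. of_real x powr s * g x) \<longlongrightarrow> 0) (at_right 0)"
    and "((\<lambda>x. of_real x powr s * g x) \<longlongrightarrow> 0) at_top"
proof -
  obtain C c where c_pos: "c > 0" and g_bound: "\<And>x. x > 0 \<Longrightarrow> norm (g x) \<le> C * exp (- (c * x))"
    using g_decay by (auto simp: exp_decay_def)
  have tendsto_0: "((\<lambda>x. of_real x powr s * g x) \<longlongrightarrow> 0) \<F>"
    if eventually_pos: "\<forall>\<^sub>F x in \<F>. x > 0"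
      and tendsto_0_bound: "((\<lambda>x. x powr Re s * exp (- (c * x))) \<longlongrightarrow> 0) \<F>" for \<F>
  proof (rule Lim_null_comparison)
    show "\<forall>\<^sub>F x in \<F>. norm (of_real x powr s * g x) \<le> C * (x powr Re s * exp (- (c * x)))"
      using eventually_pos
    proof eventually_elim
      case (elim x)
      then show ?case
        using mult_left_mono[OF g_bound[OF elim], of "x powr Re s"]
        by (simp add: norm_mult norm_powr_real_powr mult_ac)
    qed
    show "((\<lambda>x. C * (x powr Re s * exp (- (c * x)))) \<longlongrightarrow> 0) \<F>"
      by (rule tendsto_mult_right_zero[OF tendsto_0_bound])
  qed
  have "((\<lambda>x. x powr Re s * exp (- (c * x))) \<longlongrightarrow> 0) (at_right 0)"
    "((\<lambda>x. x powr Re s * exp (- (c * x))) \<longlongrightarrow> 0) at_top"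
    using Re_s c_pos by real_asymp+
  then show "((\<lambda>x. of_real x powr s * g x) \<longlongrightarrow> 0) (at_right 0)"
    and "((\<lambda>x. of_real x powr s * g x) \<longlongrightarrow> 0) at_top"
    by (auto intro!: tendsto_0 eventually_at_right_less eventually_gt_at_top)
qed

lemma mellin_derivative:
  assumes g_deriv: "\<And>x. x > 0 \<Longrightarrow> (g has_vector_derivative g' x) (at x)"
    and decay: "exp_decay g" "exp_decay g'" and Re_s: "Re s > 0"
  shows "mellin g' (s + 1) = - (s * mellin g s)"
proof -
  define h where "h = (\<lambda>x. s * (of_real x powr (s - 1) * g x) + of_real x powr (s + 1 - 1) * g' x)"
  have summands_integrable: "integrable halfline (\<lambda>x. s * (of_real x powr (s - 1) * g x))"
    "integrable halfline (\<lambda>x. of_real x powr (s + 1 - 1) * g' x)"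
    using integrable_mellin[OF decay(1) Re_s] integrable_mellin[OF decay(2), of "s + 1"] Re_s
    by auto
  have "integral\<^sup>L halfline h = 0 - 0"
  proof (rule integral_halfline_FTC)
    show "((\<lambda>x. of_real x powr s * g x) has_vector_derivative h x) (at x)" if x_pos: "x > 0" for x
    proof -
      have "((\<lambda>z. z powr s) has_field_derivative s * of_real x powr (s - 1)) (at (of_real x))"
        using x_pos by (intro has_field_derivative_powr) auto
      then have "((\<lambda>x. of_real x powr s) has_vector_derivative s * of_real x powr (s - 1)) (at x)"
        by (rule has_vector_derivative_real_field)
      from has_vector_derivative_mult[OF this g_deriv[OF x_pos]] show ?thesis
        by (simp add: h_def algebra_simps)
    qed
    show "continuous_on {0<..} h"
      using decay unfolding h_def by (intro continuous_intros) (auto simp: exp_decay_def)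
    show "integrable halfline h"
      using summands_integrable by (simp add: h_def)
  qed (rule exp_decay_powr_tendsto_0[OF decay(1) Re_s])+
  moreover have "integral\<^sup>L halfline h = s * mellin g s + mellin g' (s + 1)"
    unfolding h_def mellin_def using summands_integrable
    by (subst Bochner_Integration.integral_add) auto
  ultimately show ?thesis
    by (simp add: eq_neg_iff_add_eq_0 add.commute)
qed

lemma rGamma_mellin_exp_series:
  fixes c :: "nat \<Rightarrow> complex" and l :: "nat \<Rightarrow> real"
  assumes Re_s: "Re s > 0" and l_pos: "\<And>n. l n > 0"
    and summable: "summable (\<lambda>n. norm (c n) * l n powr (- Re s))"
    and g_sums: "\<And>x. x > 0 \<Longrightarrow> (\<lambda>n. c n * of_real (exp (- (l n * x)))) sums g x"
  shows "(\<lambda>n. c n * of_real (l n) powr (- s)) sums (rGamma s * mellin g s)"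
proof -
  define f where "f = (\<lambda>n x. c n * (complex_of_real x powr (s - 1) * of_real (exp (- (l n * x)))))"
  define I where "I = (\<lambda>n. c n * (Gamma s / of_real (l n) powr s))"
  have f_integral: "has_bochner_integral halfline (f n) (I n)" for n
    unfolding f_def I_def
    by (intro has_bochner_integral_mult_right has_bochner_integral_Gamma Re_s l_pos)
  have norm_f_integral: "has_bochner_integral halfline (\<lambda>x. norm (f n x))
                  (norm (c n) * (Gamma (Re s) / l n powr Re s))" for n
    by (rule has_bochner_integral_cong[THEN iffD1, rotated 3],
        rule has_bochner_integral_mult_right[OF has_bochner_integral_Gamma_real[OF Re_s l_pos]])
       (auto simp: f_def norm_mult norm_powr_real_powr)
  have norm_summable: "summable (\<lambda>n. norm (c n) * (Gamma (Re s) / l n powr Re s))"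
    using summable_mult[OF summable, of "Gamma (Re s)"]
    by (simp add: powr_minus divide_inverse mult_ac)
  have f_sums: "(\<lambda>n. f n x) sums (of_real x powr (s - 1) * g x)" if "x \<in> space halfline" for x
    using sums_mult[OF g_sums, of x "of_real x powr (s - 1)"] that by (simp add: f_def mult_ac)
  have "summable I" "has_bochner_integral halfline (\<lambda>x. of_real x powr (s - 1) * g x) (suminf I)"
    by (rule has_bochner_integral_sums[OF f_integral norm_f_integral norm_summable f_sums];
        assumption)+
  then have "I sums mellin g s"
    by (simp add: mellin_def has_bochner_integral_iff sums_iff)
  then have "(\<lambda>n. rGamma s * I n) sums (rGamma s * mellin g s)"
    by (rule sums_mult)
  moreover have "rGamma s * I n = c n * of_real (l n) powr (- s)" for n
  proof -
    have "s \<notin> \<int>\<^sub>\<le>\<^sub>0" using Re_s by (auto elim!: nonpos_Ints_cases)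
    then have "rGamma s * Gamma s = 1"
      by (simp add: Gamma_def rGamma_eq_zero_iff)
    then show ?thesis
      by (simp add: I_def powr_minus divide_inverse mult_ac)
  qed
  ultimately show ?thesis by simp
qed

subsection \<open>Functions decaying on a half-strip\<close>

definition half_strip :: "real \<Rightarrow> complex set" where
  "half_strip r = {z. - r < Re z \<and> \<bar>Im z\<bar> < r}"

definition strip_decay :: "(complex \<Rightarrow> complex) \<Rightarrow> bool" where
  "strip_decay F \<longleftrightarrow> (\<exists>r>0. \<exists>C\<ge>0. \<exists>c>0. F holomorphic_on half_strip r \<and>
     (\<forall>z\<in>half_strip r. norm (F z) \<le> C * exp (- (c * Re z))))"

lemma open_half_strip: "open (half_strip r)"
proof -
  have "half_strip r = {z. Re z > - r} \<inter> {z. Im z < r} \<inter> {z. Im z > - r}"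
    by (auto simp: half_strip_def)
  then show ?thesis
    by (simp add: open_Int open_halfspace_Re_gt open_halfspace_Im_lt open_halfspace_Im_gt)
qed

lemma half_strip_mono: "r \<le> R \<Longrightarrow> half_strip r \<subseteq> half_strip R"
  by (auto simp: half_strip_def)

lemma of_real_in_half_strip: "r > 0 \<Longrightarrow> x \<ge> 0 \<Longrightarrow> of_real x \<in> half_strip r"
  by (simp add: half_strip_def)

lemma strip_decayI:
  assumes R_pos: "R > 0" and c_pos: "c > 0" and F_hol: "F holomorphic_on half_strip R"
    and F_bound: "\<And>z. z \<in> half_strip R \<Longrightarrow> Re z \<ge> 1 \<Longrightarrow> norm (F z) \<le> C * exp (- (c * Re z))"
  shows "strip_decay F"
proof -
  define K where "K = cbox (Complex (- R / 2) (- R / 2)) (Complex 1 (R / 2))"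
  have "K \<subseteq> half_strip R"
    using R_pos by (auto simp: K_def half_strip_def in_cbox_complex_iff)
  then have "compact (F ` K)"
    using F_hol
    by (intro compact_continuous_image continuous_on_subset[OF holomorphic_on_imp_continuous_on])
      (auto simp: K_def)
  then obtain B where F_bound_K: "B > 0" "\<And>z. z \<in> K \<Longrightarrow> norm (F z) \<le> B"
    using compact_imp_bounded[of "F ` K"] by (auto simp: bounded_pos)
  define D where "D = B * exp c + \<bar>C\<bar>"
  have "norm (F z) \<le> D * exp (- (c * Re z))" if z_strip: "z \<in> half_strip (R / 2)" for z
  proof (cases "Re z \<le> 1")
    case True
    then have "z \<in> K"
      using z_strip by (auto simp: K_def half_strip_def in_cbox_complex_iff)
    then have "norm (F z) \<le> B * 1"
      using F_bound_K(2) by simp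
    also have "\<dots> \<le> B * (exp c * exp (- (c * Re z)))"
      using True F_bound_K(1) c_pos mult_left_mono[of "Re z" 1 c]
      by (intro mult_left_mono) (auto simp flip: exp_add)
    also have "\<dots> \<le> D * exp (- (c * Re z))"
      by (simp add: D_def algebra_simps)
    finally show ?thesis .
  next
    case False
    then have "norm (F z) \<le> C * exp (- (c * Re z))"
      using z_strip half_strip_mono[of "R / 2" R] R_pos by (intro F_bound) auto
    also have "\<dots> \<le> D * exp (- (c * Re z))"
      using F_bound_K(1) by (intro mult_right_mono) (auto simp: D_def intro: add_increasing)
    finally show ?thesis .
  qed
  moreover have "F holomorphic_on half_strip (R / 2)"
    using R_pos by (intro holomorphic_on_subset[OF F_hol] half_strip_mono) auto
  moreover have "R / 2 > 0" "D \<ge> 0"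
    using R_pos F_bound_K(1) by (auto simp: D_def)
  ultimately show ?thesis
    unfolding strip_decay_def using c_pos by blast
qed

lemma strip_decay_deriv:
  assumes "strip_decay F"
  shows "strip_decay (deriv F)"
proof -
  obtain r C c where r_pos: "r > 0" and C_nonneg: "C \<ge> 0" and c_pos: "c > 0"
    and F_hol: "F holomorphic_on half_strip r"
    and F_bound: "\<And>z. z \<in> half_strip r \<Longrightarrow> norm (F z) \<le> C * exp (- (c * Re z))"
    using assms by (auto simp: strip_decay_def)
  have deriv_F_bound: "norm (deriv F z) \<le> C * exp (c * (r / 2)) / (r / 2) * exp (- (c * Re z))"
    if z_strip: "z \<in> half_strip (r / 2)" for z
  proof -
    have near: "w \<in> half_strip r" "Re w \<ge> Re z - r / 2" if "norm (z - w) \<le> r / 2" for w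
      using z_strip that abs_Re_le_cmod[of "z - w"] abs_Im_le_cmod[of "z - w"]
      unfolding half_strip_def by (auto simp: abs_le_iff abs_less_iff)
    then have cball: "cball z (r / 2) \<subseteq> half_strip r"
      by (auto simp: dist_norm)
    have "norm ((deriv ^^ 1) F z) \<le> fact 1 * (C * exp (- (c * (Re z - r / 2)))) / (r / 2) ^ 1"
    proof (rule Cauchy_inequality)
      show "F holomorphic_on ball z (r / 2)"
        using cball by (intro holomorphic_on_subset[OF F_hol]) auto
      show "continuous_on (cball z (r / 2)) F"
        using cball by (intro continuous_on_subset[OF holomorphic_on_imp_continuous_on[OF F_hol]])
      show "norm (F w) \<le> C * exp (- (c * (Re z - r / 2)))" if "norm (z - w) = r / 2" for w
      proof -
        have "norm (F w) \<le> C * exp (- (c * Re w))"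
          using that by (intro F_bound near) auto
        also have "\<dots> \<le> C * exp (- (c * (Re z - r / 2)))"
          using near[of w] that c_pos C_nonneg by (intro mult_left_mono) auto
        finally show ?thesis .
      qed
    qed (use r_pos in auto)
    also have "exp (- (c * (Re z - r / 2))) = exp (c * (r / 2)) * exp (- (c * Re z))"
      by (simp flip: exp_add add: algebra_simps)
    finally show ?thesis by (simp add: mult_ac)
  qed
  have "deriv F holomorphic_on half_strip (r / 2)"
    using r_pos
    by (intro holomorphic_on_subset[OF holomorphic_deriv[OF F_hol open_half_strip]]
        half_strip_mono) auto
  then show ?thesis
    using r_pos by (intro strip_decayI[OF _ c_pos _ deriv_F_bound]) auto
qed

lemma strip_decay_higher_deriv: "strip_decay F \<Longrightarrow> strip_decay ((deriv ^^ n) F)"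
  by (induction n) (auto intro: strip_decay_deriv)

lemma strip_decay_factor_ident:
  assumes "strip_decay F" and F_0: "F 0 = 0"
  obtains H where "strip_decay H" "\<And>z. F z = z * H z"
proof -
  define H where "H = (\<lambda>z. if z = 0 then deriv F 0 else F z / z)"
  obtain r C c where r_pos: "r > 0" and c_pos: "c > 0" and F_hol: "F holomorphic_on half_strip r"
    and F_bound: "\<And>z. z \<in> half_strip r \<Longrightarrow> norm (F z) \<le> C * exp (- (c * Re z))"
    using assms(1) by (auto simp: strip_decay_def)
  have "strip_decay H"
  proof (rule strip_decayI[OF r_pos c_pos])
    show "H holomorphic_on half_strip r"
      by (rule pole_theorem_open_0[OF F_hol open_half_strip]) (auto simp: F_0 H_def)
    fix z assume z_strip: "z \<in> half_strip r" "Re z \<ge> 1"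
    then have "norm z \<ge> 1"
      using complex_Re_le_cmod[of z] by linarith
    then have "norm (H z) \<le> norm (F z)"
      by (auto simp: H_def norm_divide divide_le_eq mult_le_cancel_left1)
    then show "norm (H z) \<le> C * exp (- (c * Re z))"
      using F_bound[OF z_strip(1)] by linarith
  qed
  then show thesis
    by (rule that) (simp add: H_def F_0)
qed

lemma strip_decay_imp_exp_decay:
  assumes "strip_decay F"
  shows "exp_decay (\<lambda>x. F (of_real x))"
proof -
  obtain r C c where r_pos: "r > 0" and c_pos: "c > 0" and F_hol: "F holomorphic_on half_strip r"
    and F_bound: "\<And>z. z \<in> half_strip r \<Longrightarrow> norm (F z) \<le> C * exp (- (c * Re z))"
    using assms by (auto simp: strip_decay_def)
  have "continuous_on {0<..} (\<lambda>x. F (of_real x))"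
    using r_pos
    by (intro continuous_on_compose2[OF holomorphic_on_imp_continuous_on[OF F_hol]]
        continuous_intros)
      (auto intro!: of_real_in_half_strip)
  moreover have "norm (F (of_real x)) \<le> C * exp (- (c * x))" if "x > 0" for x
    using F_bound[OF of_real_in_half_strip[OF r_pos, of x]] that by simp
  ultimately show ?thesis
    using c_pos by (auto simp: exp_decay_def)
qed

lemma strip_decay_has_field_derivative:
  assumes "strip_decay F" "x \<ge> 0"
  shows "(F has_field_derivative deriv F (of_real x)) (at (of_real x))"
proof -
  obtain r where r_pos: "r > 0" and F_hol: "F holomorphic_on half_strip r"
    using assms(1) by (auto simp: strip_decay_def)
  show ?thesis
    using r_pos assms(2)
    by (intro holomorphic_derivI[OF F_hol open_half_strip] of_real_in_half_strip)
qed

lemma mellin_deriv: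
  assumes "strip_decay F" "Re s > 0"
  shows "mellin (\<lambda>x. deriv F (of_real x)) (s + 1) = - (s * mellin (\<lambda>x. F (of_real x)) s)"
  using assms
  by (intro mellin_derivative has_vector_derivative_real_field strip_decay_has_field_derivative
      strip_decay_imp_exp_decay strip_decay_deriv) auto

subsection \<open>The normalised Mellin transform\<close>

text \<open>The transform \<open>(\<integral>x\<^bsup>s-1\<^esup> F x dx) / \<Gamma>(s)\<close>. Integrating by parts \<open>n\<close> times shows that it is entire,
  and that any \<open>n\<close> for which the integral converges gives the same value.\<close>

definition normalized_mellin :: "(complex \<Rightarrow> complex) \<Rightarrow> complex \<Rightarrow> complex" where
  "normalized_mellin F s = (let n = nat \<lceil>1 - Re s\<rceil> in
     (-1) ^ n * rGamma (s + of_nat n) * mellin (\<lambda>x. (deriv ^^ n) F (of_real x)) (s + of_nat n))"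

lemma normalized_mellin_eq:
  assumes F_decay: "strip_decay F" and Re_s_plus_n: "Re s + real n > 0"
  shows "normalized_mellin F s =
    (-1) ^ n * rGamma (s + of_nat n) * mellin (\<lambda>x. (deriv ^^ n) F (of_real x)) (s + of_nat n)"
proof -
  define h where "h = (\<lambda>n. (-1) ^ n * rGamma (s + of_nat n) *
     mellin (\<lambda>x. (deriv ^^ n) F (of_real x)) (s + of_nat n))"
  have h_Suc: "h (Suc k) = h k" if "Re s + real k > 0" for k
  proof -
    have by_parts: "mellin (\<lambda>x. (deriv ^^ Suc k) F (of_real x)) (s + of_nat k + 1) =
          - ((s + of_nat k) * mellin (\<lambda>x. (deriv ^^ k) F (of_real x)) (s + of_nat k))"
      using mellin_deriv[OF strip_decay_higher_deriv[OF F_decay, of k], of "s + of_nat k"] that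
      by simp
    have "h (Suc k) = (-1) ^ k * ((s + of_nat k) * rGamma (s + of_nat k + 1)) *
          mellin (\<lambda>x. (deriv ^^ k) F (of_real x)) (s + of_nat k)"
      using by_parts by (simp add: h_def add_ac mult_ac del: funpow.simps)
    then show ?thesis
      by (simp add: h_def rGamma_plus1)
  qed
  have h_eq: "h m = h k" if "Re s + real k > 0" "k \<le> m" for k m
    using that(2) by (induction m rule: dec_induct) (use that(1) h_Suc in auto)
  let ?m = "nat \<lceil>1 - Re s\<rceil>"
  have Re_s_plus_m: "Re s + real ?m > 0" by linarith
  have "h ?m = h n"
    using h_eq[OF Re_s_plus_m, of n] h_eq[OF Re_s_plus_n, of ?m] by (cases "?m \<le> n") auto
  then show ?thesis by (simp add: normalized_mellin_def h_def Let_def)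
qed

lemma normalized_mellin_eq_mellin:
  "strip_decay F \<Longrightarrow> Re s > 0 \<Longrightarrow> normalized_mellin F s = rGamma s * mellin (\<lambda>x. F (of_real x)) s"
  using normalized_mellin_eq[of F s 0] by simp

lemma normalized_mellin_deriv:
  assumes F_decay: "strip_decay F"
  shows "normalized_mellin (deriv F) (s + 1) = - normalized_mellin F s"
proof -
  define n where "n = nat \<lceil>1 - Re s\<rceil>"
  have Re_s_plus_n: "Re s + real n > 0" unfolding n_def by linarith
  have "(deriv ^^ Suc n) F = (deriv ^^ n) (deriv F)"
    by (simp add: funpow_swap1)
  then show ?thesis
    using normalized_mellin_eq[OF F_decay, of s "Suc n"]
      normalized_mellin_eq[OF strip_decay_deriv[OF F_decay], of "s + 1" n] Re_s_plus_n
    by (simp add: add_ac del: funpow.simps)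
qed

lemma normalized_mellin_holomorphic:
  assumes F_decay: "strip_decay F"
  shows "normalized_mellin F holomorphic_on A"
proof -
  have "normalized_mellin F holomorphic_on {s. Re s > - real n}" for n
  proof (rule holomorphic_transform)
    have "mellin (\<lambda>x. (deriv ^^ n) F (of_real x)) holomorphic_on {s. Re s > 0}"
      by (intro mellin_holomorphic strip_decay_imp_exp_decay strip_decay_higher_deriv F_decay)
    then have "(\<lambda>s. mellin (\<lambda>x. (deriv ^^ n) F (of_real x)) (s + of_nat n))
                 holomorphic_on {s. Re s > - real n}"
      by (rule holomorphic_on_compose_gen[unfolded o_def, rotated])
        (auto intro!: holomorphic_intros)
    then show "(\<lambda>s. (-1) ^ n * rGamma (s + of_nat n) *
        mellin (\<lambda>x. (deriv ^^ n) F (of_real x)) (s + of_nat n)) holomorphic_on {s. Re s > - real n}"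
      by (intro holomorphic_intros)
  qed (rule normalized_mellin_eq[OF F_decay, symmetric], simp)
  then have "normalized_mellin F holomorphic_on (\<Union>n. {s. Re s > - real n})"
    by (intro holomorphic_on_UN_open open_halfspace_Re_gt)
  moreover have "\<exists>n. Re s > - real n" for s
    using reals_Archimedean2[of "- Re s"] by (auto simp: minus_less_iff)
  ultimately show ?thesis
    by (auto intro: holomorphic_on_subset)
qed

lemma normalized_mellin_holomorphic' [holomorphic_intros]:
  assumes "strip_decay F" "f holomorphic_on A"
  shows "(\<lambda>s. normalized_mellin F (f s)) holomorphic_on A"
  using holomorphic_on_compose[OF assms(2) normalized_mellin_holomorphic[OF assms(1)]]
  by (simp add: o_def)

lemma entire_eqI_halfplane:
  assumes "f holomorphic_on UNIV" "g holomorphic_on UNIV" "\<And>z. Re z > a \<Longrightarrow> f z = g z"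
  shows "f = g"
proof
  fix z
  show "f z = g z"
  proof
    (rule analytic_continuation_open[where s = "{z. Re z > a}" and s' = UNIV and f = f and g = g])
    have "of_real (a + 1) \<in> {z. Re z > a}" by simp
    then show "{z. Re z > a} \<noteq> {}" by blast
  qed (use assms in \<open>auto simp: open_halfspace_Re_gt\<close>)
qed

lemma normalized_mellin_times_ident:
  assumes F_decay: "strip_decay F" and G_decay: "strip_decay G"
    and F_eq: "\<And>x. x > 0 \<Longrightarrow> F (of_real x) = of_real x * G (of_real x)"
  shows "normalized_mellin F = (\<lambda>s. s * normalized_mellin G (s + 1))"
proof (rule entire_eqI_halfplane)
  fix s :: complex assume Re_s: "Re s > 0"
  have "mellin (\<lambda>x. F (of_real x)) s = mellin (\<lambda>x. G (of_real x)) (s + 1)"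
    using mellin_cong[OF F_eq] by (simp add: mellin_times_ident)
  then show "normalized_mellin F s = s * normalized_mellin G (s + 1)"
    using Re_s rGamma_plus1[of s]
    by (simp add: normalized_mellin_eq_mellin F_decay G_decay flip: mult.assoc)
qed (intro holomorphic_intros normalized_mellin_holomorphic F_decay G_decay)+

text \<open>If \<open>F' z = z H z\<close>, then the transform of \<open>F\<close> at \<open>s\<close> is \<open>- (s + 1)\<close> times that of \<open>H\<close> at
  \<open>s + 2\<close>; hence it vanishes at \<open>-1\<close>, with derivative \<open>- \<integral>H x dx\<close>.\<close>

lemma strip_decay_diff_bounds:
  assumes F_decay: "strip_decay F" and H_factor: "strip_decay H" "\<And>z. deriv F z = z * H z"
  obtains B where "\<And>x. x > 0 \<Longrightarrow> norm (F 0 - F (of_real x)) \<le> B"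
    and "\<And>x. x > 0 \<Longrightarrow> norm (F 0 - F (of_real x)) \<le> B * x\<^sup>2"
proof -
  obtain B where H_bound: "\<And>t. t > 0 \<Longrightarrow> norm (H (of_real t)) \<le> B"
    using strip_decay_imp_exp_decay[OF H_factor(1)] by (rule exp_decay_bounded) blast
  obtain D where F_bound: "\<And>x. x > 0 \<Longrightarrow> norm (F (of_real x)) \<le> D"
    using strip_decay_imp_exp_decay[OF F_decay] by (rule exp_decay_bounded) blast
  have B_nonneg: "B \<ge> 0"
    using order_trans[OF norm_ge_zero H_bound[of 1]] by simp
  have "norm (F 0 - F (of_real x)) \<le> B * x\<^sup>2" if x_pos: "x > 0" for x
  proof -
    have "norm (F 0 - F (of_real x)) \<le> B * x * norm (0 - complex_of_real x)"
    proof (rule field_differentiable_bound[of "of_real ` {0..x}" F "deriv F"])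
      show "convex (complex_of_real ` {0..x})"
        by (intro convex_linear_image bounded_linear.linear bounded_linear_of_real) auto
      fix z assume "z \<in> complex_of_real ` {0..x}"
      then obtain t where z_eq_t: "z = of_real t" "0 \<le> t" "t \<le> x"
        by auto
      then show "(F has_field_derivative deriv F z) (at z within of_real ` {0..x})"
        by (auto intro: has_field_derivative_at_within strip_decay_has_field_derivative F_decay)
      have "norm (deriv F z) \<le> t * B"
        using z_eq_t H_bound[of t]
        by (cases "t = 0") (auto simp: H_factor(2) norm_mult mult_left_mono)
      also have "\<dots> \<le> x * B"
        using z_eq_t B_nonneg by (intro mult_right_mono)
      finally show "norm (deriv F z) \<le> B * x"
        by (simp add: mult.commute)
    qed (use x_pos in auto)
    then show ?thesis
      using x_pos by (simp add: power2_eq_square mult.assoc)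
  qed
  moreover have "norm (F 0 - F (of_real x)) \<le> norm (F 0) + D" if "x > 0" for x
    using norm_triangle_ineq4[of "F 0" "F (of_real x)"] F_bound[OF that] by linarith
  ultimately show thesis
    by (intro that[of "max B (norm (F 0) + D)"]) (auto simp: le_max_iff_disj max_mult_distrib_right)
qed

lemma integrable_diff_over_square:
  assumes F_decay: "strip_decay F" and H_factor: "strip_decay H" "\<And>z. deriv F z = z * H z"
  shows "integrable halfline (\<lambda>x. (F 0 - F (of_real x)) / of_real (x\<^sup>2))"
proof -
  obtain B where diff_bounds: "\<And>x. x > 0 \<Longrightarrow> norm (F 0 - F (of_real x)) \<le> B"
    "\<And>x. x > 0 \<Longrightarrow> norm (F 0 - F (of_real x)) \<le> B * x\<^sup>2"
    by (rule strip_decay_diff_bounds[OF F_decay H_factor]) blast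
  show ?thesis
  proof (rule Bochner_Integration.integrable_bound)
    show "integrable halfline (\<lambda>x. 2 * B * (1 / (1\<^sup>2 + x\<^sup>2)))"
      using has_bochner_integral_inverse_square_plus_square[of 1]
      by (intro integrable_mult_right) (simp add: has_bochner_integral_iff)
    have "continuous_on {0<..} (\<lambda>x. F (of_real x))"
      using strip_decay_imp_exp_decay[OF F_decay] by (simp add: exp_decay_def)
    then show "(\<lambda>x. (F 0 - F (of_real x)) / of_real (x\<^sup>2)) \<in> borel_measurable halfline"
      by (intro borel_measurable_halfline continuous_intros) auto
    have "norm ((F 0 - F (of_real x)) / of_real (x\<^sup>2)) \<le> norm (2 * B * (1 / (1\<^sup>2 + x\<^sup>2)))"
      if x_pos: "x > 0" for x
    proof -
      have "norm (F 0 - F (of_real x)) * (1 + x\<^sup>2) \<le> B * x\<^sup>2 + B * x\<^sup>2"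
        unfolding distrib_left using diff_bounds[OF x_pos] by (intro add_mono mult_right_mono) auto
      moreover have "1 + x\<^sup>2 > 0"
        by (simp add: add_pos_nonneg)
      ultimately have "norm (F 0 - F (of_real x)) / x\<^sup>2 \<le> 2 * B * (1 / (1\<^sup>2 + x\<^sup>2))"
        using x_pos by (simp add: divide_le_eq pos_le_divide_eq mult_ac)
      also have "\<dots> \<le> norm \<dots>"
        by (simp only: real_norm_def abs_ge_self)
      finally show ?thesis
        using x_pos by (simp add: norm_divide norm_power)
    qed
    then show "AE x in halfline. norm ((F 0 - F (of_real x)) / of_real (x\<^sup>2))
                 \<le> norm (2 * B * (1 / (1\<^sup>2 + x\<^sup>2)))"
      by (intro AE_I2) simp
  qed
qed

lemma strip_decay_diff_quotient_tendsto_0: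
  assumes F_decay: "strip_decay F" and H_factor: "strip_decay H" "\<And>z. deriv F z = z * H z"
  shows "((\<lambda>x. (F (of_real x) - F 0) / of_real x) \<longlongrightarrow> 0) (at_right 0)"
    and "((\<lambda>x. (F (of_real x) - F 0) / of_real x) \<longlongrightarrow> 0) at_top"
proof -
  obtain B where diff_bounds: "\<And>x. x > 0 \<Longrightarrow> norm (F 0 - F (of_real x)) \<le> B"
    "\<And>x. x > 0 \<Longrightarrow> norm (F 0 - F (of_real x)) \<le> B * x\<^sup>2"
    by (rule strip_decay_diff_bounds[OF F_decay H_factor]) blast
  have quotient_bounds: "norm ((F (of_real x) - F 0) / of_real x) \<le> B * x"
    "norm ((F (of_real x) - F 0) / of_real x) \<le> B / x" if "x > 0" for x
    using diff_bounds[OF that] that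
    by (simp_all add: norm_divide norm_minus_commute divide_le_eq divide_right_mono
        power2_eq_square mult.assoc)
  show "((\<lambda>x. (F (of_real x) - F 0) / of_real x) \<longlongrightarrow> 0) (at_right 0)"
  proof (rule Lim_null_comparison)
    show "\<forall>\<^sub>F x in at_right 0. norm ((F (of_real x) - F 0) / of_real x) \<le> B * x"
      using eventually_at_right_less[of 0] by eventually_elim (rule quotient_bounds)
    show "((\<lambda>x. B * x) \<longlongrightarrow> 0) (at_right 0)"
      by real_asymp
  qed
  show "((\<lambda>x. (F (of_real x) - F 0) / of_real x) \<longlongrightarrow> 0) at_top"
  proof (rule Lim_null_comparison)
    show "\<forall>\<^sub>F x in at_top. norm ((F (of_real x) - F 0) / of_real x) \<le> B / x"
      using eventually_gt_at_top[of 0] by eventually_elim (rule quotient_bounds)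
    show "((\<lambda>x. B / x) \<longlongrightarrow> 0) at_top"
      by real_asymp
  qed
qed

lemma integral_diff_over_square:
  assumes F_decay: "strip_decay F" and H_factor: "strip_decay H" "\<And>z. deriv F z = z * H z"
  shows "(\<integral>x. (F 0 - F (of_real x)) / of_real (x\<^sup>2) \<partial>halfline) = - (\<integral>x. H (of_real x) \<partial>halfline)"
proof -
  have decay: "exp_decay (\<lambda>x. F (of_real x))" "exp_decay (\<lambda>x. H (of_real x))"
    by (intro strip_decay_imp_exp_decay F_decay H_factor(1))+
  have integrable: "integrable halfline (\<lambda>x. (F 0 - F (of_real x)) / of_real (x\<^sup>2))"
    "integrable halfline (\<lambda>x. H (of_real x))"
    by (intro integrable_diff_over_square[OF F_decay H_factor] integrable_exp_decay decay)+
  have "(\<integral>x. H (of_real x) + (F 0 - F (of_real x)) / of_real (x\<^sup>2) \<partial>halfline) = 0 - 0"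
  proof (rule integral_halfline_FTC)
    show "((\<lambda>x. (F (of_real x) - F 0) / of_real x) has_vector_derivative
             H (of_real x) + (F 0 - F (of_real x)) / of_real (x\<^sup>2)) (at x)" if "x > 0" for x
    proof -
      let ?z = "complex_of_real x"
      have "((\<lambda>z. (F z - F 0) / z) has_field_derivative
          ((deriv F ?z - 0) * ?z - (F ?z - F 0) * 1) / (?z * ?z)) (at ?z)"
        using that
        by (intro DERIV_divide DERIV_diff DERIV_const DERIV_ident strip_decay_has_field_derivative
            F_decay) auto
      also have
        "((deriv F ?z - 0) * ?z - (F ?z - F 0) * 1) / (?z * ?z) =
           H ?z + (F 0 - F ?z) / of_real (x\<^sup>2)"
        using that by (simp add: H_factor(2) field_simps power2_eq_square)
      finally show ?thesis
        by (rule has_vector_derivative_real_field)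
    qed
    show "continuous_on {0<..} (\<lambda>x. H (of_real x) + (F 0 - F (of_real x)) / of_real (x\<^sup>2))"
      using decay unfolding exp_decay_def by (intro continuous_intros) auto
  qed (intro Bochner_Integration.integrable_add integrable
      strip_decay_diff_quotient_tendsto_0[OF F_decay H_factor])+
  then show ?thesis
    using integrable by (simp add: add_eq_0_iff)
qed

lemma normalized_mellin_at_minus_1:
  assumes F_decay: "strip_decay F" and F'_0: "deriv F 0 = 0"
  shows "normalized_mellin F (-1) = 0"
    and "integrable halfline (\<lambda>x. (F 0 - F (of_real x)) / of_real (x\<^sup>2))"
    and "(normalized_mellin F has_field_derivative
           (\<integral>x. (F 0 - F (of_real x)) / of_real (x\<^sup>2) \<partial>halfline)) (at (-1))"
proof -
  obtain H where H_factor: "strip_decay H" "\<And>z. deriv F z = z * H z"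
    using strip_decay_factor_ident[OF strip_decay_deriv[OF F_decay] F'_0] by blast
  have "normalized_mellin (deriv F) = (\<lambda>s. s * normalized_mellin H (s + 1))"
    by (intro normalized_mellin_times_ident strip_decay_deriv F_decay H_factor)
  then have transform_eq: "normalized_mellin F s = - ((s + 1) * normalized_mellin H (s + 2))" for s
    using normalized_mellin_deriv[OF F_decay, of s] by (simp add: add.assoc minus_equation_iff)
  show "normalized_mellin F (-1) = 0"
    by (simp add: transform_eq)
  show "integrable halfline (\<lambda>x. (F 0 - F (of_real x)) / of_real (x\<^sup>2))"
    by (rule integrable_diff_over_square[OF F_decay H_factor])
  have "(normalized_mellin H has_field_derivative deriv (normalized_mellin H) 1) (at 1)"
    using normalized_mellin_holomorphic[OF H_factor(1)] by (rule holomorphic_derivI[of _ UNIV]) auto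
  then have "((\<lambda>s. normalized_mellin H (s + 2)) has_field_derivative
               deriv (normalized_mellin H) 1 * 1) (at (-1))"
    by (intro DERIV_chain2[of "normalized_mellin H"]) (auto intro!: derivative_eq_intros)
  then have "(normalized_mellin F has_field_derivative - normalized_mellin H 1) (at (-1))"
    unfolding transform_eq[abs_def] by (auto intro!: derivative_eq_intros)
  moreover have "normalized_mellin H 1 = (\<integral>x. H (of_real x) \<partial>halfline)"
    by (simp add: normalized_mellin_eq_mellin H_factor(1) mellin_1)
  ultimately show "(normalized_mellin F has_field_derivative
           (\<integral>x. (F 0 - F (of_real x)) / of_real (x\<^sup>2) \<partial>halfline)) (at (-1))"
    by (simp only: integral_diff_over_square[OF F_decay H_factor])
qed

subsection \<open>The Hurwitz zeta function\<close>

lemma remove_sings_nicely_meromorphic_eq: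
  "f nicely_meromorphic_on A \<Longrightarrow> z \<in> A \<Longrightarrow> remove_sings f z = f z"
  by (auto simp: nicely_meromorphic_on_def)

lemma nicely_meromorphic_eqI:
  assumes f_nicely: "f nicely_meromorphic_on UNIV" and g_nicely: "g nicely_meromorphic_on UNIV"
    and f_eq_g_on_U: "open U" "U \<noteq> {}" "\<And>z. z \<in> U \<Longrightarrow> f z = g z"
  shows "f = g"
proof
  define d where "d = (\<lambda>z. f z - g z)"
  have d_meromorphic: "d meromorphic_on UNIV"
    using f_nicely g_nicely unfolding d_def nicely_meromorphic_on_def
    by (intro meromorphic_intros) auto
  have remove_sings_d_eq: "\<forall>\<^sub>F w in at z. remove_sings d w = d w" for z
    using d_meromorphic by (intro eventually_remove_sings_eq_at meromorphic_on_isolated_singularity)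
      (auto intro: meromorphic_on_subset)
  obtain u where u_in_U: "u \<in> U" using f_eq_g_on_U(2) by auto
  have "\<forall>\<^sub>F w in at u. remove_sings d w = 0"
    using remove_sings_d_eq[of u] eventually_at_in_open'[OF f_eq_g_on_U(1) u_in_U]
    by eventually_elim (use f_eq_g_on_U(3) in \<open>auto simp: d_def\<close>)
  then have "\<exists>\<^sub>F w in at u. remove_sings d w = 0"
    by (intro eventually_frequently) auto
  then have remove_sings_d_eq_0: "remove_sings d w = 0" for w
    using remove_sings_nicely_meromorphic[OF d_meromorphic]
    by (rule frequently_eq_meromorphic_imp_constant) auto
  have "\<forall>\<^sub>F w in at z. f w = g w" for z
    using remove_sings_d_eq[of z]
    by eventually_elim (simp add: remove_sings_d_eq_0, simp add: d_def)
  then have "remove_sings f z = remove_sings g z" for z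
    by (rule remove_sings_cong) simp
  then show "f z = g z" for z
    by (simp add: remove_sings_nicely_meromorphic_eq[OF f_nicely]
        remove_sings_nicely_meromorphic_eq[OF g_nicely])
qed

lemma hurwitz_zeta_eqI:
  assumes f_nicely: "f nicely_meromorphic_on UNIV"
    and f_sums: "\<And>z. Re z > 1 \<Longrightarrow> (\<lambda>n. of_real (real n + a) powr (- z)) sums f z"
  shows "hurwitz_zeta s a = f s"
proof -
  have "(THE f. f nicely_meromorphic_on UNIV \<and>
             (\<forall>z. Re z > 1 \<longrightarrow> f z = (\<Sum>n. of_real (real n + a) powr (- z)))) = f"
  proof (rule the_equality)
    show "g = f" if g_nicely_sums: "g nicely_meromorphic_on UNIV \<and>
             (\<forall>z. Re z > 1 \<longrightarrow> g z = (\<Sum>n. of_real (real n + a) powr (- z)))" for g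
    proof (rule nicely_meromorphic_eqI)
      have "2 \<in> {z. Re z > 1}" by simp
      then show "{z. Re z > 1} \<noteq> {}" by blast
      show "g z = f z" if "z \<in> {z. Re z > 1}" for z
        using g_nicely_sums f_sums[of z] that by (simp add: sums_iff)
    qed (use g_nicely_sums f_nicely in \<open>auto simp: open_halfspace_Re_gt\<close>)
  qed (use f_nicely f_sums in \<open>auto simp: sums_iff\<close>)
  then show ?thesis
    by (simp add: hurwitz_zeta_def)
qed

definition zeta_kernel :: "real \<Rightarrow> complex \<Rightarrow> complex" where
  "zeta_kernel a z = (if z = 0 then 1 else z * exp (- (of_real a * z)) / (1 - exp (- z)))"

lemma zeta_kernel_holomorphic: "zeta_kernel a holomorphic_on half_strip 2"
proof -
  define q where "q = (\<lambda>z::complex. if z = 0 then 1 else (1 - exp (- z)) / z)"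
  have "((\<lambda>z. 1 - exp (- z)) has_field_derivative 1) (at (0 :: complex))"
    by (auto intro!: derivative_eq_intros)
  then have "deriv (\<lambda>z. 1 - exp (- z)) (0 :: complex) = 1"
    by (rule DERIV_imp_deriv)
  then have "q holomorphic_on half_strip 2"
    by (intro pole_theorem_open_0[of "\<lambda>z. 1 - exp (- z)" _ 0 q] holomorphic_intros open_half_strip)
       (auto simp: q_def)
  moreover have "q z \<noteq> 0" if "z \<in> half_strip 2" for z
  proof
    assume q_eq_0: "q z = 0"
    then have "exp (- z) = 1" by (auto simp: q_def split: if_splits)
    moreover have "Ln (exp (- z)) = - z"
      using that pi_gt3 by (intro Ln_exp) (auto simp: half_strip_def)
    ultimately show False using q_eq_0 by (auto simp: q_def)
  qed
  ultimately have "(\<lambda>z. exp (- (of_real a * z)) / q z) holomorphic_on half_strip 2"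
    by (intro holomorphic_intros)
  then show ?thesis
    by (rule holomorphic_transform) (auto simp: zeta_kernel_def q_def)
qed

lemma strip_decay_zeta_kernel:
  assumes a_pos: "a > 0"
  shows "strip_decay (zeta_kernel a)"
proof (rule strip_decayI[OF _ _ zeta_kernel_holomorphic])
  fix z assume z_strip: "z \<in> half_strip 2" "Re z \<ge> 1"
  define t where "t = Re z"
  have t_ge_1: "t \<ge> 1" "z \<noteq> 0" using z_strip by (auto simp: t_def)
  have "2 \<le> exp t"
    using exp_ge_add_one_self[of t] t_ge_1 by linarith
  then have "1 / 2 \<le> 1 - exp (- t)"
    by (simp add: exp_minus divide_simps)
  also have "\<dots> \<le> norm (1 - exp (- z))"
    using norm_triangle_ineq2[of 1 "exp (- z)"] by (simp add: t_def)
  finally have denominator: "1 / 2 \<le> norm (1 - exp (- z))" .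
  have "norm z \<le> \<bar>Re z\<bar> + \<bar>Im z\<bar>" by (rule cmod_le)
  also have "\<dots> \<le> 3 * t" using z_strip t_ge_1 by (auto simp: half_strip_def t_def)
  also have "\<dots> \<le> 6 / a * exp (a / 2 * t)"
    using exp_ge_add_one_self[of "a / 2 * t"] a_pos by (simp add: field_simps)
  finally have numerator: "norm z \<le> 6 / a * exp (a / 2 * t)" .
  have "norm (zeta_kernel a z) = norm z * exp (- (a * t)) / norm (1 - exp (- z))"
    using t_ge_1 by (simp add: zeta_kernel_def norm_mult norm_divide t_def)
  also have "\<dots> \<le> (6 / a * exp (a / 2 * t)) * exp (- (a * t)) / (1 / 2)"
    using denominator numerator a_pos by (intro frac_le mult_right_mono) auto
  also have "\<dots> = 12 / a * exp (- (a / 2 * t))"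
    by (simp flip: exp_add add: field_simps)
  finally show "norm (zeta_kernel a z) \<le> 12 / a * exp (- (a / 2 * Re z))"
    by (simp add: t_def)
qed (use a_pos in auto)

lemma summable_shifted_powr:
  assumes "a > 0" "\<sigma> > 1"
  shows "summable (\<lambda>n. (real n + a) powr (- \<sigma>))"
proof (rule summable_comparison_test_ev)
  show "summable (\<lambda>n. real n powr (- \<sigma>))"
    using assms by (simp add: summable_real_powr_iff)
  show "\<forall>\<^sub>F n in sequentially. norm ((real n + a) powr (- \<sigma>)) \<le> real n powr (- \<sigma>)"
    using eventually_gt_at_top[of 0] by eventually_elim (use assms in \<open>auto intro!: powr_mono2'\<close>)
qed

lemma hurwitz_series_sums:
  assumes a_pos: "a > 0" and Re_s: "Re s > 1"
  shows
    "(\<lambda>n. of_real (real n + a) powr (- s)) sums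
       (normalized_mellin (zeta_kernel a) (s - 1) / (s - 1))"
proof -
  define g where "g = (\<lambda>x. of_real (exp (- (a * x)) / (1 - exp (- x))) :: complex)"
  have g_sums: "(\<lambda>n. 1 * complex_of_real (exp (- ((real n + a) * x)))) sums g x" if "x > 0" for x
  proof -
    have "(\<lambda>n. exp (- (a * x)) * exp (- x) ^ n) sums (exp (- (a * x)) * (1 / (1 - exp (- x))))"
      using that by (intro sums_mult geometric_sums) auto
    then have "(\<lambda>n. exp (- ((real n + a) * x))) sums (exp (- (a * x)) / (1 - exp (- x)))"
      by (simp flip: exp_of_nat_mult exp_add add: algebra_simps)
    then show ?thesis
      unfolding g_def mult_1 by (rule sums_of_real)
  qed
  have "(\<lambda>n. 1 * of_real (real n + a) powr (- s)) sums (rGamma s * mellin g s)"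
    using summable_shifted_powr[OF a_pos Re_s] Re_s a_pos
    by (intro rGamma_mellin_exp_series g_sums) auto
  moreover have
    "mellin (\<lambda>x. zeta_kernel a (of_real x)) (s - 1) = mellin (\<lambda>x. of_real x * g x) (s - 1)"
    by (rule mellin_cong) (simp add: zeta_kernel_def g_def flip: exp_of_real)
  moreover have "rGamma (s - 1) = (s - 1) * rGamma s"
    using rGamma_plus1[of "s - 1"] by simp
  moreover have "s \<noteq> 1" using Re_s by auto
  ultimately show ?thesis
    using Re_s
    by (simp add: normalized_mellin_eq_mellin strip_decay_zeta_kernel a_pos mellin_times_ident)
qed

lemma hurwitz_zeta_eq_normalized_mellin:
  assumes a_pos: "a > 0" and s_neq_1: "s \<noteq> 1"
  shows "hurwitz_zeta s a = normalized_mellin (zeta_kernel a) (s - 1) / (s - 1)"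
proof -
  define g where "g = (\<lambda>s. normalized_mellin (zeta_kernel a) (s - 1) / (s - 1))"
  have numerator_hol: "(\<lambda>s. normalized_mellin (zeta_kernel a) (s - 1)) holomorphic_on A" for A
    by (intro holomorphic_intros strip_decay_zeta_kernel a_pos)
  then have "g holomorphic_on - {1}"
    unfolding g_def by (rule holomorphic_on_divide) (auto intro!: holomorphic_intros)
  then have remove_sings_g: "remove_sings g z = g z" if "z \<noteq> 1" for z
    using that
    by (intro remove_sings_at_analytic) (auto simp: analytic_at intro!: exI[of _ "- {1}"])
  have "(\<lambda>s. normalized_mellin (zeta_kernel a) (s - 1)) analytic_on UNIV"
    using numerator_hol by (simp add: analytic_on_open)
  then have "g meromorphic_on UNIV"
    unfolding g_def by (intro meromorphic_intros analytic_on_imp_meromorphic_on)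
  then have "remove_sings g nicely_meromorphic_on UNIV"
    by (rule remove_sings_nicely_meromorphic)
  then have "hurwitz_zeta s a = remove_sings g s"
  proof (rule hurwitz_zeta_eqI)
    fix z :: complex assume Re_z: "Re z > 1"
    then have "z \<noteq> 1" by auto
    then show "(\<lambda>n. of_real (real n + a) powr (- z)) sums remove_sings g z"
      using hurwitz_series_sums[OF a_pos Re_z] remove_sings_g[of z] by (simp add: g_def)
  qed
  then show ?thesis
    using remove_sings_g[OF s_neq_1] by (simp add: g_def)
qed

lemma hurwitz_zeta_field_differentiable:
  assumes a_pos: "a > 0" and s_neq_1: "s \<noteq> 1"
  shows "(\<lambda>z. hurwitz_zeta z a) field_differentiable (at s)"
proof -
  have "(\<lambda>z. normalized_mellin (zeta_kernel a) (z - 1) / (z - 1)) holomorphic_on - {1}"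
    by (intro holomorphic_intros strip_decay_zeta_kernel a_pos) auto
  then have "(\<lambda>z. hurwitz_zeta z a) holomorphic_on - {1}"
    by (rule holomorphic_transform) (simp add: hurwitz_zeta_eq_normalized_mellin a_pos)
  then show ?thesis
    using s_neq_1 by (intro holomorphic_on_imp_differentiable_at[of _ "- {1}"]) auto
qed

lemma norm_one_plus_exp_ge_1:
  fixes z :: complex
  assumes "\<bar>Im z\<bar> \<le> pi / 2"
  shows "norm (1 + exp z) \<ge> 1"
proof -
  have "cos (Im z) \<ge> 0"
    using assms by (intro cos_ge_zero) auto
  then have "1 \<le> Re (1 + exp z)"
    by (simp add: Re_exp)
  also have "\<dots> \<le> norm (1 + exp z)"
    by (rule complex_Re_le_cmod)
  finally show ?thesis .
qed

definition eta_kernel :: "real \<Rightarrow> complex \<Rightarrow> complex" where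
  "eta_kernel a z = exp (- (of_real a * z)) / (1 + exp (- (z / 2)))"

lemma strip_decay_eta_kernel:
  assumes a_pos: "a > 0"
  shows "strip_decay (eta_kernel a)"
proof -
  have denominator: "norm (1 + exp (- (z / 2))) \<ge> 1" if "z \<in> half_strip 1" for z
    using that pi_gt3 by (intro norm_one_plus_exp_ge_1) (auto simp: half_strip_def)
  then have "1 + exp (- (z / 2)) \<noteq> 0" if "z \<in> half_strip 1" for z
    using that by force
  then have eta_kernel_hol: "eta_kernel a holomorphic_on half_strip 1"
    unfolding eta_kernel_def by (intro holomorphic_intros) auto
  have eta_kernel_bound: "norm (eta_kernel a z) \<le> 1 * exp (- (a * Re z))" if "z \<in> half_strip 1"
    for z
    using denominator[OF that]
    by (simp add: eta_kernel_def norm_divide divide_le_eq mult_le_cancel_left1)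
  show ?thesis
    by (rule strip_decayI[OF _ a_pos eta_kernel_hol eta_kernel_bound]) auto
qed

lemma zeta_kernel_diff_half:
  assumes x_pos: "x > 0"
  shows
    "zeta_kernel a (of_real x) - zeta_kernel (a + 1 / 2) (of_real x) =
       of_real x * eta_kernel a (of_real x)"
proof -
  define q where "q = exp (- (complex_of_real x / 2))"
  define e where "e = of_real x * exp (- (of_real a * complex_of_real x))"
  have "norm q < 1"
    using x_pos by (simp add: q_def)
  then have q_neq: "1 - q \<noteq> 0" "1 + q \<noteq> 0"
    by (auto simp: add_eq_0_iff)
  have "1 - exp (- complex_of_real x) = (1 - q) * (1 + q)"
    by (simp add: q_def algebra_simps flip: exp_add)
  moreover have "of_real x * exp (- (of_real (a + 1 / 2) * of_real x)) = e * q"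
    by (simp add: e_def q_def algebra_simps flip: exp_add)
  ultimately have "zeta_kernel a (of_real x) - zeta_kernel (a + 1 / 2) (of_real x) =
      (e * (1 - q)) / ((1 - q) * (1 + q))"
    using x_pos by (simp add: zeta_kernel_def e_def diff_divide_distrib right_diff_distrib)
  also have "\<dots> = of_real x * eta_kernel a (of_real x)"
    using q_neq by (simp add: eta_kernel_def e_def q_def)
  finally show ?thesis .
qed

lemma hurwitz_zeta_diff_half:
  assumes a_pos: "a > 0" and s_neq_1: "s \<noteq> 1"
  shows "hurwitz_zeta s a - hurwitz_zeta s (a + 1 / 2) = normalized_mellin (eta_kernel a) s"
proof -
  let ?N = "\<lambda>a s. normalized_mellin (zeta_kernel a) (s - 1)"
  have decay: "strip_decay (zeta_kernel a)" "strip_decay (zeta_kernel (a + 1 / 2))"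
    "strip_decay (eta_kernel a)"
    using a_pos by (auto intro: strip_decay_zeta_kernel strip_decay_eta_kernel)
  have "(\<lambda>s. ?N a s - ?N (a + 1 / 2) s) = (\<lambda>s. (s - 1) * normalized_mellin (eta_kernel a) s)"
  proof (rule entire_eqI_halfplane)
    fix z :: complex assume Re_z: "Re z > 1"
    let ?M = "\<lambda>b. mellin (\<lambda>x. zeta_kernel b (of_real x)) (z - 1)"
    have "?M a - ?M (a + 1 / 2) =
          mellin (\<lambda>x. 1 * zeta_kernel a (of_real x) + (- 1) * zeta_kernel (a + 1 / 2) (of_real x))
            (z - 1)"
      using decay Re_z by (subst mellin_linear) (auto intro: strip_decay_imp_exp_decay)
    also have "\<dots> = mellin (\<lambda>x. of_real x * eta_kernel a (of_real x)) (z - 1)"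
      by (rule mellin_cong) (simp flip: zeta_kernel_diff_half)
    also have "\<dots> = mellin (\<lambda>x. eta_kernel a (of_real x)) z"
      by (simp add: mellin_times_ident)
    finally show "?N a z - ?N (a + 1 / 2) z = (z - 1) * normalized_mellin (eta_kernel a) z"
      using Re_z rGamma_plus1[of "z - 1"]
      by (simp add: normalized_mellin_eq_mellin decay flip: right_diff_distrib)
  qed (intro holomorphic_intros decay)+
  then have "?N a s - ?N (a + 1 / 2) s = (s - 1) * normalized_mellin (eta_kernel a) s"
    by (rule fun_cong)
  then show ?thesis
    using a_pos s_neq_1 by (simp add: hurwitz_zeta_eq_normalized_mellin flip: diff_divide_distrib)
qed

lemma hurwitz_zeta_deriv_diff_half:
  assumes a_pos: "a > 0" and s_neq_1: "s \<noteq> 1"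
  shows
    "hurwitz_zeta_deriv s a - hurwitz_zeta_deriv s (a + 1 / 2) =
       deriv (normalized_mellin (eta_kernel a)) s"
proof -
  have "hurwitz_zeta_deriv s a - hurwitz_zeta_deriv s (a + 1 / 2) =
        deriv (\<lambda>z. hurwitz_zeta z a - hurwitz_zeta z (a + 1 / 2)) s"
    unfolding hurwitz_zeta_deriv_def using a_pos s_neq_1
    by (intro deriv_diff[symmetric] hurwitz_zeta_field_differentiable) auto
  also have "\<dots> = deriv (normalized_mellin (eta_kernel a)) s"
  proof (rule deriv_cong_ev)
    have "\<forall>\<^sub>F z in nhds s. z \<in> - {1}"
      using s_neq_1 by (intro eventually_nhds_in_open) auto
    then show
      "\<forall>\<^sub>F z in nhds s. hurwitz_zeta z a - hurwitz_zeta z (a + 1 / 2) =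
         normalized_mellin (eta_kernel a) z"
      by eventually_elim (simp add: hurwitz_zeta_diff_half a_pos)
  qed simp
  finally show ?thesis .
qed

lemma zeta_bracket_half:
  assumes a_pos: "a > 0"
  shows "zeta_bracket s a (a + 1 / 2) = deriv (normalized_mellin (eta_kernel a)) s"
proof (cases "s = 1")
  case True
  have "deriv (normalized_mellin (eta_kernel a)) holomorphic_on UNIV"
    by (intro holomorphic_deriv normalized_mellin_holomorphic strip_decay_eta_kernel a_pos) auto
  then have
    "(deriv (normalized_mellin (eta_kernel a)) \<longlongrightarrow> deriv (normalized_mellin (eta_kernel a)) 1) (at 1)"
    using holomorphic_on_imp_continuous_on by (auto simp: continuous_on_def)
  then have "((\<lambda>z. hurwitz_zeta_deriv z a - hurwitz_zeta_deriv z (a + 1 / 2))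
               \<longlongrightarrow> deriv (normalized_mellin (eta_kernel a)) 1) (at 1)"
    by (rule Lim_transform_eventually)
      (auto simp: eventually_at_filter hurwitz_zeta_deriv_diff_half a_pos)
  then show ?thesis
    using True by (simp add: zeta_bracket_def tendsto_Lim)
qed (simp add: zeta_bracket_def hurwitz_zeta_deriv_diff_half a_pos)

subsection \<open>The partial fraction expansion of the hyperbolic secant\<close>

lemma Digamma_diff_sums:
  fixes z w :: complex
  assumes "z \<noteq> 0" "w \<noteq> 0"
  shows "(\<lambda>k. inverse (w + of_nat k) - inverse (z + of_nat k)) sums (Digamma z - Digamma w)"
proof -
  have "(\<lambda>k. (inverse (of_nat (Suc k)) - inverse (z + of_nat k)) -
             (inverse (of_nat (Suc k)) - inverse (w + of_nat k))) sums
        ((\<Sum>k. inverse (of_nat (Suc k)) - inverse (z + of_nat k)) -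
         (\<Sum>k. inverse (of_nat (Suc k)) - inverse (w + of_nat k)))"
    by (intro sums_diff summable_sums summable_Digamma assms)
  then show ?thesis
    by (simp add: Digamma_def algebra_simps)
qed

lemma Digamma_diff_half_sums:
  fixes z :: complex
  assumes "z \<noteq> 0" "z \<noteq> -1"
  shows "(\<lambda>k. inverse (z + of_nat (2 * k)) - inverse (z + of_nat (2 * k + 1))) sums
           ((Digamma ((z + 1) / 2) - Digamma (z / 2)) / 2)"
proof -
  have "(z + 1) / 2 \<noteq> 0" "z / 2 \<noteq> 0"
    using assms by (auto simp: add_eq_0_iff2)
  then have "(\<lambda>k. (inverse (z / 2 + of_nat k) - inverse ((z + 1) / 2 + of_nat k)) / 2) sums
          ((Digamma ((z + 1) / 2) - Digamma (z / 2)) / 2)"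
    by (intro sums_divide Digamma_diff_sums)
  moreover have "inverse (z / 2 + of_nat k) = 2 * inverse (z + of_nat (2 * k))"
    "inverse ((z + 1) / 2 + of_nat k) = 2 * inverse (z + of_nat (2 * k + 1))" for k
  proof -
    have inverse_half: "inverse (w / 2) = 2 * inverse w" for w :: complex
      by (simp add: inverse_eq_divide)
    have "z / 2 + of_nat k = (z + of_nat (2 * k)) / 2"
      "(z + 1) / 2 + of_nat k = (z + of_nat (2 * k + 1)) / 2"
      by (simp_all add: field_simps)
    then show "inverse (z / 2 + of_nat k) = 2 * inverse (z + of_nat (2 * k))"
      "inverse ((z + 1) / 2 + of_nat k) = 2 * inverse (z + of_nat (2 * k + 1))"
      by (simp_all only: inverse_half)
  qed
  ultimately show ?thesis
    by (simp add: diff_divide_distrib)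
qed

lemma sin_pi_times_eq_0_iff:
  fixes z :: complex
  shows "sin (of_real pi * z) = 0 \<longleftrightarrow> z \<in> \<int>"
  unfolding sin_eq_0 Ints_def by (auto simp: complex_eq_iff)

lemma Digamma_reflection:
  fixes z :: complex
  assumes z_not_int: "z \<notin> \<int>"
  shows "Digamma (1 - z) - Digamma z = of_real pi * cot (of_real pi * z)"
proof -
  have "1 - z \<notin> \<int>"
    using z_not_int Ints_diff[of 1 "1 - z"] by auto
  then have "z \<notin> \<int>\<^sub>\<le>\<^sub>0" "1 - z \<notin> \<int>\<^sub>\<le>\<^sub>0"
    using z_not_int by (auto dest: nonpos_Ints_Int)
  then have "((\<lambda>z. rGamma z * rGamma (1 - z)) has_field_derivative
          rGamma z * rGamma (1 - z) * (Digamma (1 - z) - Digamma z)) (at z)"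
    by (auto intro!: derivative_eq_intros simp: algebra_simps)
  then have "((\<lambda>z. sin (of_real pi * z) / of_real pi) has_field_derivative
          sin (of_real pi * z) / of_real pi * (Digamma (1 - z) - Digamma z)) (at z)"
    by (simp add: rGamma_reflection_complex)
  moreover have
    "((\<lambda>z. sin (of_real pi * z) / of_real pi) has_field_derivative cos (of_real pi * z)) (at z)"
    by (auto intro!: derivative_eq_intros)
  ultimately have
    "sin (of_real pi * z) / of_real pi * (Digamma (1 - z) - Digamma z) = cos (of_real pi * z)"
    by (rule DERIV_unique)
  then show ?thesis
    using z_not_int by (simp add: cot_def field_simps flip: sin_pi_times_eq_0_iff)
qed

lemma cot_plus_tan:
  fixes w :: "'a :: {real_normed_field, banach}"
  assumes "sin (2 * w) \<noteq> 0"
  shows "cot w + tan w = 2 / sin (2 * w)"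
proof -
  have "sin w \<noteq> 0" "cos w \<noteq> 0"
    using assms by (auto simp: sin_double)
  then have "cot w + tan w = ((sin w)\<^sup>2 + (cos w)\<^sup>2) / (sin w * cos w)"
    by (simp add: cot_def tan_def add_divide_distrib power2_eq_square)
  also have "\<dots> = 2 / sin (2 * w)"
    by (simp add: sin_double)
  finally show ?thesis .
qed

lemma Digamma_half_differences:
  fixes z :: complex
  assumes z_not_int: "z \<notin> \<int>"
  shows "(Digamma ((z + 1) / 2) - Digamma (z / 2)) +
           (Digamma ((1 - z + 1) / 2) - Digamma ((1 - z) / 2)) =
         2 * (of_real pi / sin (of_real pi * z))"
proof -
  define w where "w = of_real pi * (z / 2)"
  have half_not_int: "u / 2 \<notin> \<int>" if "u \<notin> \<int>" for u :: complex
    using that Ints_mult[of 2 "u / 2"] by auto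
  have "1 - z \<notin> \<int>"
    using z_not_int Ints_diff[of 1 "1 - z"] by auto
  have "1 - z / 2 = (1 - z + 1) / 2"
    by (simp add: field_simps)
  then have cot_w: "Digamma ((1 - z + 1) / 2) - Digamma (z / 2) = of_real pi * cot w"
    using Digamma_reflection[OF half_not_int[OF z_not_int]] by (simp only: w_def)
  have "1 - (1 - z) / 2 = (z + 1) / 2" "of_real pi * ((1 - z) / 2) = of_real pi / 2 - w"
    by (simp_all add: w_def field_simps)
  then have "Digamma ((z + 1) / 2) - Digamma ((1 - z) / 2) = of_real pi * cot (of_real pi / 2 - w)"
    using Digamma_reflection[OF half_not_int[OF \<open>1 - z \<notin> \<int>\<close>]] by (simp only:)
  then have tan_w: "Digamma ((z + 1) / 2) - Digamma ((1 - z) / 2) = of_real pi * tan w"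
    by (simp add: cot_def tan_def sin_diff cos_diff)
  have "sin (2 * w) \<noteq> 0"
    using z_not_int by (simp add: w_def sin_pi_times_eq_0_iff)
  then have "cot w + tan w = 2 / sin (2 * w)"
    by (rule cot_plus_tan)
  then have "of_real pi * cot w + of_real pi * tan w = 2 * (of_real pi / sin (of_real pi * z))"
    by (simp add: w_def flip: distrib_left)
  then show ?thesis
    unfolding cot_w[symmetric] tan_w[symmetric] by (simp add: algebra_simps)
qed

lemma cosec_partial_fractions:
  fixes z :: complex
  assumes z_not_int: "z \<notin> \<int>"
  shows "(\<lambda>k. (inverse (z + of_nat (2 * k)) + inverse (1 - z + of_nat (2 * k))) -
              (inverse (z + of_nat (2 * k + 1)) + inverse (1 - z + of_nat (2 * k + 1)))) sums
         (of_real pi / sin (of_real pi * z))"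
proof -
  have z_neq_of_int: "z \<noteq> of_int n" for n
    using z_not_int by auto
  have nonzero: "z \<noteq> 0" "z \<noteq> -1" "1 - z \<noteq> 0" "1 - z \<noteq> -1"
    using z_neq_of_int[of 0] z_neq_of_int[of "-1"] z_neq_of_int[of 1] z_neq_of_int[of 2]
    by (auto simp: algebra_simps)
  have "(\<lambda>k. (inverse (z + of_nat (2 * k)) - inverse (z + of_nat (2 * k + 1))) +
             (inverse (1 - z + of_nat (2 * k)) - inverse (1 - z + of_nat (2 * k + 1)))) sums
        ((Digamma ((z + 1) / 2) - Digamma (z / 2)) / 2 +
         (Digamma ((1 - z + 1) / 2) - Digamma ((1 - z) / 2)) / 2)"
    by (intro sums_add Digamma_diff_half_sums nonzero)
  also have
    "(Digamma ((z + 1) / 2) - Digamma (z / 2)) / 2 +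
       (Digamma ((1 - z + 1) / 2) - Digamma ((1 - z) / 2)) / 2 =
      of_real pi / sin (of_real pi * z)"
    unfolding add_divide_distrib[symmetric] Digamma_half_differences[OF z_not_int] by simp
  finally show ?thesis
    by (simp only: add_diff_add)
qed

lemma cosh_complex_of_real: "cosh (complex_of_real x) = of_real (cosh x)"
  by (simp add: cosh_def scaleR_conv_of_real flip: exp_of_real)

text \<open>The poles of \<open>sech\<close> are \<open>\<plusminus>i sech_pole n\<close>. Consecutive terms of the partial fraction expansion
  are paired, because the series itself converges only conditionally.\<close>

definition sech_pole :: "nat \<Rightarrow> real" where
  "sech_pole n = pi * (real n + 1 / 2)"

lemma sech_pole_pos: "sech_pole n > 0"
  by (simp add: sech_pole_def add_nonneg_pos)

lemma inverse_add_inverse_conjugate: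
  assumes "b \<noteq> 0"
  shows "inverse (of_real b + \<i> * of_real y) + inverse (of_real b - \<i> * of_real y) =
     of_real (2 * b / (b\<^sup>2 + y\<^sup>2))"
proof -
  have "of_real b + \<i> * of_real y \<noteq> 0" "of_real b - \<i> * of_real y \<noteq> 0"
    using assms by (auto simp: complex_eq_iff)
  then have "inverse (of_real b + \<i> * of_real y) + inverse (of_real b - \<i> * of_real y) =
      2 * of_real b / ((of_real b + \<i> * of_real y) * (of_real b - \<i> * of_real y))"
    by (simp add: field_simps)
  also have "(of_real b + \<i> * of_real y) * (of_real b - \<i> * of_real y) = of_real (b\<^sup>2 + y\<^sup>2)"
    by (simp add: algebra_simps power2_eq_square)
  finally show ?thesis
    by simp
qed

lemma inverse_add_inverse_eq_sech_pole:
  fixes x :: real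
  defines "z \<equiv> 1 / 2 + \<i> * complex_of_real (x / pi)"
  shows "inverse (z + of_nat n) + inverse (1 - z + of_nat n) =
           of_real (pi * (2 * sech_pole n / ((sech_pole n)\<^sup>2 + x\<^sup>2)))"
proof -
  let ?b = "real n + 1 / 2"
  have "z + of_nat n = of_real ?b + \<i> * of_real (x / pi)"
    "1 - z + of_nat n = of_real ?b - \<i> * of_real (x / pi)"
    by (simp_all add: z_def)
  then have
    "inverse (z + of_nat n) + inverse (1 - z + of_nat n) = of_real (2 * ?b / (?b\<^sup>2 + (x / pi)\<^sup>2))"
    by (simp only: inverse_add_inverse_conjugate)
  also have "2 * ?b / (?b\<^sup>2 + (x / pi)\<^sup>2) = pi\<^sup>2 * (2 * ?b) / (pi\<^sup>2 * (?b\<^sup>2 + (x / pi)\<^sup>2))"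
    by simp
  also have "pi\<^sup>2 * (?b\<^sup>2 + (x / pi)\<^sup>2) = (sech_pole n)\<^sup>2 + x\<^sup>2"
    unfolding sech_pole_def power_mult_distrib distrib_left[of "pi\<^sup>2"] by (simp add: power_divide)
  finally show ?thesis
    by (simp add: sech_pole_def power2_eq_square mult_ac)
qed

lemma sech_partial_fractions:
  "(\<lambda>k. 2 * sech_pole (2 * k) / ((sech_pole (2 * k))\<^sup>2 + x\<^sup>2) -
        2 * sech_pole (2 * k + 1) / ((sech_pole (2 * k + 1))\<^sup>2 + x\<^sup>2)) sums sech x"
proof -
  define z where "z = 1 / 2 + \<i> * complex_of_real (x / pi)"
  define T where "T = (\<lambda>n. 2 * sech_pole n / ((sech_pole n)\<^sup>2 + x\<^sup>2))"
  have z_not_int: "z \<notin> \<int>"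
  proof
    assume "z \<in> \<int>"
    then obtain n :: int where "z = of_int n" by (rule Ints_cases)
    then have "of_int (2 * n) = (1 :: real)"
      by (auto simp: z_def complex_eq_iff)
    then have "2 * n = 1"
      by (simp only: of_int_eq_1_iff)
    then show False by presburger
  qed
  have "of_real pi * z = of_real pi / 2 + \<i> * of_real x"
    by (simp add: z_def field_simps)
  then have "sin (of_real pi * z) = of_real (cosh x)"
    by (simp add: sin_add flip: cosh_conv_cos) (rule cosh_complex_of_real)
  moreover have "inverse (z + of_nat n) + inverse (1 - z + of_nat n) = of_real (pi * T n)" for n
    unfolding T_def z_def by (rule inverse_add_inverse_eq_sech_pole)
  ultimately have "(\<lambda>k. complex_of_real (pi * T (2 * k)) - of_real (pi * T (2 * k + 1))) sums
                     (of_real pi / of_real (cosh x))"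
    using cosec_partial_fractions[OF z_not_int] by (simp only:)
  then have "(\<lambda>k. complex_of_real (pi * (T (2 * k) - T (2 * k + 1)))) sums of_real (pi * sech x)"
    by (simp add: sech_def right_diff_distrib)
  then have "(\<lambda>k. pi * (T (2 * k) - T (2 * k + 1))) sums (pi * sech x)"
    by (simp only: sums_of_real_iff)
  then show ?thesis
    by (simp add: T_def sums_mult_iff)
qed

lemma sums_pairsD:
  fixes f :: "nat \<Rightarrow> 'a :: {t2_space, topological_comm_monoid_add}"
  assumes "summable f" "(\<lambda>k. f (2 * k) + f (2 * k + 1)) sums s"
  shows "f sums s"
proof -
  have "(\<lambda>k. sum f {k * 2..<k * 2 + 2}) sums suminf f"
    using assms(1) by (intro sums_group summable_sums) auto
  moreover have "sum f {k * 2..<k * 2 + 2} = f (2 * k) + f (2 * k + 1)" for k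
    by (simp add: mult.commute numeral_2_eq_2)
  ultimately show ?thesis
    using assms by (simp add: sums_iff)
qed

lemma summable_inverse_sech_pole_square: "summable (\<lambda>n. 1 / (sech_pole n)\<^sup>2)"
proof (rule summable_comparison_test')
  show "summable (\<lambda>n. 1 / real n ^ 2)"
    using inverse_power_summable[of 2] by (simp add: field_simps)
  fix n :: nat assume n_pos: "n \<ge> 1"
  have "1 * real n \<le> pi * (real n + 1 / 2)"
    using pi_gt3 by (intro mult_mono) auto
  then have "1 / (sech_pole n)\<^sup>2 \<le> 1 / real n ^ 2"
    using n_pos
    by (intro divide_left_mono power_mono) (auto simp: sech_pole_def intro!: add_nonneg_pos)
  then show "norm (1 / (sech_pole n)\<^sup>2) \<le> 1 / real n ^ 2"
    by simp
qed

lemma one_minus_sech_over_square_sums: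
  assumes x_nonzero: "x \<noteq> 0"
  shows "(\<lambda>n. (-1) ^ n * (2 / sech_pole n * (1 / ((sech_pole n)\<^sup>2 + x\<^sup>2)))) sums ((1 - sech x) / x\<^sup>2)"
proof (rule sums_pairsD)
  let ?T = "\<lambda>x n. 2 * sech_pole n / ((sech_pole n)\<^sup>2 + x\<^sup>2)"
  define h where "h = (\<lambda>n. 2 / sech_pole n * (1 / ((sech_pole n)\<^sup>2 + x\<^sup>2)))"
  have "(\<lambda>k. ((?T 0 (2 * k) - ?T 0 (2 * k + 1)) - (?T x (2 * k) - ?T x (2 * k + 1))) / x\<^sup>2) sums
          ((sech 0 - sech x) / x\<^sup>2)"
    by (intro sums_divide sums_diff sech_partial_fractions)
  moreover have term_diff: "?T 0 n / x\<^sup>2 - ?T x n / x\<^sup>2 = h n" for n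
  proof -
    have "(sech_pole n)\<^sup>2 + x\<^sup>2 > 0"
      using sech_pole_pos[of n] by (simp add: add_pos_nonneg)
    then show ?thesis
      using sech_pole_pos[of n] x_nonzero
      by (simp add: h_def divide_simps) (simp add: algebra_simps power2_eq_square)
  qed
  have "((?T 0 (2 * k) - ?T 0 (2 * k + 1)) - (?T x (2 * k) - ?T x (2 * k + 1))) / x\<^sup>2 =
      (-1) ^ (2 * k) * h (2 * k) + (-1) ^ (2 * k + 1) * h (2 * k + 1)" for k
    unfolding term_diff[symmetric] by (simp add: diff_divide_distrib)
  ultimately show "(\<lambda>k. (-1) ^ (2 * k) * h (2 * k) + (-1) ^ (2 * k + 1) * h (2 * k + 1)) sums
      ((1 - sech x) / x\<^sup>2)"
    by (simp only:) (simp add: sech_def)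
  show "summable (\<lambda>n. (-1) ^ n * h n)"
  proof (rule summable_comparison_test')
    show "summable (\<lambda>n. 1 / (sech_pole n)\<^sup>2 * (2 / (pi / 2)))"
      by (intro summable_mult2 summable_inverse_sech_pole_square)
    show "norm ((-1) ^ n * h n) \<le> 1 / (sech_pole n)\<^sup>2 * (2 / (pi / 2))" for n
    proof -
      have "norm ((-1) ^ n * h n) = 1 / ((sech_pole n)\<^sup>2 + x\<^sup>2) * (2 / sech_pole n)"
        using sech_pole_pos[of n] by (simp add: h_def abs_mult power_abs)
      also have "\<dots> \<le> 1 / (sech_pole n)\<^sup>2 * (2 / (pi / 2))"
        using sech_pole_pos[of n]
        by (intro mult_mono divide_left_mono) (auto simp: sech_pole_def add_pos_nonneg)
      finally show ?thesis .
    qed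
  qed
qed

lemma has_bochner_integral_one_minus_sech_over_square:
  "has_bochner_integral halfline (\<lambda>x. (1 - sech x) / x\<^sup>2) (4 * catalan_const / pi)"
proof -
  define f where "f = (\<lambda>n x. (-1) ^ n * (2 / sech_pole n * (1 / ((sech_pole n)\<^sup>2 + x\<^sup>2))))"
  have coeff: "(-1) ^ n * (2 / sech_pole n * (pi / (2 * sech_pole n))) =
      4 / pi * ((-1) ^ n / (2 * real n + 1)\<^sup>2)" for n
  proof -
    define d where "d = 2 * real n + 1"
    have pole: "sech_pole n = pi / 2 * d" and "d > 0" by (auto simp: d_def sech_pole_def)
    then show ?thesis
      unfolding d_def[symmetric] pole by (simp add: field_simps power2_eq_square)
  qed
  have f_integral: "has_bochner_integral halfline (f n) (4 / pi * ((-1) ^ n / (2 * real n + 1)\<^sup>2))"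
    for n
    unfolding f_def coeff[symmetric]
    by (intro has_bochner_integral_mult_right has_bochner_integral_inverse_square_plus_square
        sech_pole_pos)
  have "norm (f n x) = 2 / sech_pole n * (1 / ((sech_pole n)\<^sup>2 + x\<^sup>2))" for n x
    using sech_pole_pos[of n] by (simp add: f_def abs_mult power_abs)
  then have norm_f_integral:
    "has_bochner_integral halfline (\<lambda>x. norm (f n x))
       (2 / sech_pole n * (pi / (2 * sech_pole n)))" for n
    by (simp only:)
      (intro has_bochner_integral_mult_right has_bochner_integral_inverse_square_plus_square
          sech_pole_pos)
  have norm_summable: "summable (\<lambda>n. 2 / sech_pole n * (pi / (2 * sech_pole n)))"
    using summable_mult[OF summable_inverse_sech_pole_square, of pi] by (simp add: power2_eq_square)
  have f_sums: "(\<lambda>n. f n x) sums ((1 - sech x) / x\<^sup>2)" if "x \<in> space halfline" for x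
    using that unfolding f_def by (intro one_minus_sech_over_square_sums) auto
  have "summable (\<lambda>n. 4 / pi * ((-1) ^ n / (2 * real n + 1)\<^sup>2))"
    by (rule has_bochner_integral_sums(1)[OF f_integral norm_f_integral norm_summable f_sums])
        assumption
  then have "summable (\<lambda>n. (-1) ^ n / (2 * real n + 1)\<^sup>2)"
    by (subst (asm) summable_cmult_iff) auto
  then have "(\<Sum>n. 4 / pi * ((-1) ^ n / (2 * real n + 1)\<^sup>2)) = 4 / pi * catalan_const"
    unfolding catalan_const_def by (rule suminf_mult)
  moreover have "has_bochner_integral halfline (\<lambda>x. (1 - sech x) / x\<^sup>2)
      (\<Sum>n. 4 / pi * ((-1) ^ n / (2 * real n + 1)\<^sup>2))"
    by (rule has_bochner_integral_sums(2)[OF f_integral norm_f_integral norm_summable f_sums])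
        assumption
  ultimately show ?thesis
    by simp
qed

subsection \<open>Powers of the hyperbolic secant\<close>

definition csech_pow :: "nat \<Rightarrow> complex \<Rightarrow> complex" where
  "csech_pow j z = inverse (cosh z) ^ j"

lemma csech_pow_of_real: "csech_pow j (of_real x) = of_real (sech x ^ j)"
  by (simp add: csech_pow_def sech_def cosh_complex_of_real inverse_eq_divide)

lemma csech_pow_0: "csech_pow j 0 = 1"
  by (simp add: csech_pow_def)

lemma cosh_eq_exp_times:
  fixes z :: complex
  shows "cosh z = exp z / 2 * (1 + exp (- (2 * z)))"
  by (simp add: cosh_field_def algebra_simps flip: exp_add)

lemma norm_cosh_ge:
  assumes "z \<in> half_strip (1 / 2)"
  shows "norm (cosh z) \<ge> exp (Re z) / 2"
proof -
  have "1 \<le> norm (1 + exp (- (2 * z)))"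
    using assms pi_gt3 by (intro norm_one_plus_exp_ge_1) (auto simp: half_strip_def)
  then have "exp (Re z) / 2 * 1 \<le> exp (Re z) / 2 * norm (1 + exp (- (2 * z)))"
    by (intro mult_left_mono) auto
  then show ?thesis
    by (simp add: cosh_eq_exp_times norm_mult norm_divide)
qed

lemma cosh_nonzero_half_strip:
  assumes "z \<in> half_strip (1 / 2)"
  shows "cosh z \<noteq> 0"
proof
  assume "cosh z = 0"
  then have "exp (Re z) \<le> 0"
    using norm_cosh_ge[OF assms] by simp
  then show False
    using exp_gt_zero[of "Re z"] by linarith
qed

lemma strip_decay_csech_pow:
  assumes j_pos: "j \<ge> 1"
  shows "strip_decay (csech_pow j)"
proof -
  have "(\<lambda>z. cos (\<i> * z)) holomorphic_on half_strip (1 / 2)"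
    by (intro holomorphic_intros)
  then have csech_pow_hol: "csech_pow j holomorphic_on half_strip (1 / 2)"
    unfolding csech_pow_def using cosh_nonzero_half_strip
    by (intro holomorphic_intros) (auto simp: cosh_conv_cos)
  have "norm (csech_pow j z) \<le> 2 ^ j * exp (- (real j * Re z))"
    if z_strip: "z \<in> half_strip (1 / 2)" for z
  proof -
    have "inverse (norm (cosh z)) \<le> inverse (exp (Re z) / 2)"
      using norm_cosh_ge[OF z_strip] by (intro le_imp_inverse_le) auto
    also have "\<dots> = 2 * exp (- Re z)"
      by (simp add: exp_minus field_simps)
    finally have "inverse (norm (cosh z)) ^ j \<le> (2 * exp (- Re z)) ^ j"
      by (intro power_mono) auto
    then show ?thesis
      by (simp add: csech_pow_def norm_power norm_inverse power_mult_distrib flip: exp_of_nat_mult)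
  qed
  then show ?thesis
    using j_pos by (intro strip_decayI[OF _ _ csech_pow_hol]) auto
qed

lemma csech_pow_has_field_derivative:
  assumes "cosh z \<noteq> 0"
  shows "(csech_pow j has_field_derivative - (of_nat j * tanh z * csech_pow j z)) (at z)"
proof -
  have "((\<lambda>z. inverse (cosh z)) has_field_derivative - (tanh z * inverse (cosh z))) (at z)"
    using assms by (auto intro!: derivative_eq_intros simp: tanh_def divide_inverse)
  then have "((\<lambda>z. inverse (cosh z) ^ j) has_field_derivative
      of_nat j * (- (tanh z * inverse (cosh z)) * inverse (cosh z) ^ (j - Suc 0))) (at z)"
    by (rule DERIV_power)
  then show ?thesis
    unfolding csech_pow_def[abs_def] by (cases j) (simp_all add: mult_ac)
qed

lemma csech_pow_has_field_derivative2:
  assumes "cosh z \<noteq> 0"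
  shows "((\<lambda>z. - (of_nat j * tanh z * csech_pow j z)) has_field_derivative
           (of_nat j ^ 2 * csech_pow j z - of_nat j * (of_nat j + 1) * csech_pow (j + 2) z)) (at z)"
proof -
  have "(tanh z)\<^sup>2 = 1 - (inverse (cosh z))\<^sup>2"
    using assms
    by (simp add: tanh_def sinh_square_eq power_divide diff_divide_distrib power_inverse
        inverse_eq_divide)
  then have csech_pow_tanh: "csech_pow (j + 2) z = (1 - (tanh z)\<^sup>2) * csech_pow j z"
    by (simp add: csech_pow_def power_add power2_eq_square)
  have "(tanh has_field_derivative 1 - (tanh z)\<^sup>2) (at z)"
    using assms by (auto intro!: derivative_eq_intros)
  then have "((\<lambda>z. - (of_nat j * tanh z * csech_pow j z)) has_field_derivative
      - (of_nat j * (1 - (tanh z)\<^sup>2) * csech_pow j z + - (of_nat j * tanh z * csech_pow j z) *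
          (of_nat j * tanh z))) (at z)"
    using assms
    by (intro DERIV_minus DERIV_mult DERIV_cmult csech_pow_has_field_derivative)
  then show ?thesis
    unfolding csech_pow_tanh by (simp add: algebra_simps power2_eq_square)
qed

lemma deriv_deriv_csech_pow:
  assumes "cosh z \<noteq> 0"
  shows "deriv (deriv (csech_pow j)) z =
           of_nat j ^ 2 * csech_pow j z - of_nat j * (of_nat j + 1) * csech_pow (j + 2) z"
proof -
  have "open {w::complex. cosh w \<noteq> 0}"
    by (intro open_Collect_neq continuous_intros)
  then have "\<forall>\<^sub>F w in nhds z. cosh w \<noteq> 0"
    using assms eventually_nhds_in_open[of "{w. cosh w \<noteq> 0}" z] by simp
  then have "\<forall>\<^sub>F w in nhds z. deriv (csech_pow j) w = - (of_nat j * tanh w * csech_pow j w)"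
    by eventually_elim (intro DERIV_imp_deriv csech_pow_has_field_derivative)
  then have "deriv (deriv (csech_pow j)) z = deriv (\<lambda>w. - (of_nat j * tanh w * csech_pow j w)) z"
    by (rule deriv_cong_ev) simp
  also have "\<dots> = of_nat j ^ 2 * csech_pow j z - of_nat j * (of_nat j + 1) * csech_pow (j + 2) z"
    using assms by (intro DERIV_imp_deriv csech_pow_has_field_derivative2)
  finally show ?thesis .
qed

lemma normalized_mellin_csech_pow_shift:
  assumes j_pos: "j \<ge> 1" and Re_s: "Re s > 0"
  shows "normalized_mellin (csech_pow j) (s - 2) =
           of_nat j ^ 2 * normalized_mellin (csech_pow j) s
           - of_nat j * (of_nat j + 1) * normalized_mellin (csech_pow (j + 2)) s"
proof -
  have decay: "strip_decay (csech_pow j)" "strip_decay (csech_pow (j + 2))"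
    using j_pos by (auto intro: strip_decay_csech_pow)
  have "normalized_mellin (csech_pow j) (s - 2) = normalized_mellin (deriv (deriv (csech_pow j))) s"
    using normalized_mellin_deriv[OF decay(1), of "s - 2"]
      normalized_mellin_deriv[OF strip_decay_deriv[OF decay(1)], of "s - 1"] by simp
  also have "\<dots> = rGamma s * mellin (\<lambda>x. deriv (deriv (csech_pow j)) (of_real x)) s"
    by (intro normalized_mellin_eq_mellin strip_decay_deriv decay Re_s)
  also have "mellin (\<lambda>x. deriv (deriv (csech_pow j)) (of_real x)) s =
      mellin (\<lambda>x. of_nat j ^ 2 * csech_pow j (of_real x) +
                  (- (of_nat j * (of_nat j + 1))) * csech_pow (j + 2) (of_real x)) s"
    by (rule mellin_cong) (simp add: deriv_deriv_csech_pow cosh_complex_of_real)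
  also have "\<dots> = of_nat j ^ 2 * mellin (\<lambda>x. csech_pow j (of_real x)) s +
                  (- (of_nat j * (of_nat j + 1))) * mellin (\<lambda>x. csech_pow (j + 2) (of_real x)) s"
    by (intro mellin_linear strip_decay_imp_exp_decay decay Re_s)
  finally show ?thesis
    using Re_s decay by (simp add: normalized_mellin_eq_mellin algebra_simps)
qed

lemma normalized_mellin_csech_pow_at_minus_1:
  assumes j_pos: "j \<ge> 1"
  shows "normalized_mellin (csech_pow j) (-1) = 0"
    and "integrable halfline (\<lambda>x. (1 - sech x ^ j) / x\<^sup>2)"
    and "(normalized_mellin (csech_pow j) has_field_derivative
           of_real (\<integral>x. (1 - sech x ^ j) / x\<^sup>2 \<partial>halfline)) (at (-1))"
proof -
  have "deriv (csech_pow j) 0 = 0"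
    using csech_pow_has_field_derivative[of 0 j] by (intro DERIV_imp_deriv) simp
  note at_minus_1 = normalized_mellin_at_minus_1[OF strip_decay_csech_pow[OF j_pos] this]
  have integrand: "(csech_pow j 0 - csech_pow j (of_real x)) / of_real (x\<^sup>2) =
      of_real ((1 - sech x ^ j) / x\<^sup>2)" for x
    by (simp add: csech_pow_0 csech_pow_of_real)
  show "normalized_mellin (csech_pow j) (-1) = 0"
    by (rule at_minus_1(1))
  show "integrable halfline (\<lambda>x. (1 - sech x ^ j) / x\<^sup>2)"
    using at_minus_1(2) unfolding integrand by (simp only: complex_of_real_integrable_eq)
  show "(normalized_mellin (csech_pow j) has_field_derivative
           of_real (\<integral>x. (1 - sech x ^ j) / x\<^sup>2 \<partial>halfline)) (at (-1))"
    using at_minus_1(3) unfolding integrand by (simp only: integral_complex_of_real)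
qed

subsection \<open>Stirling polynomials and the Dirichlet series of powers of the hyperbolic secant\<close>

lemma eta_series_sums:
  assumes a_pos: "a > 0" and Re_s: "Re s > 1"
  shows
    "(\<lambda>n. (-1) ^ n * of_real (real n / 2 + a) powr (- s)) sums normalized_mellin (eta_kernel a) s"
proof -
  have "summable (\<lambda>n. (1 / 2) powr (- Re s) * (real n + 2 * a) powr (- Re s))"
    using summable_shifted_powr[of "2 * a" "Re s"] a_pos Re_s by (intro summable_mult) auto
  also have "(\<lambda>n. (1 / 2) powr (- Re s) * (real n + 2 * a) powr (- Re s)) =
             (\<lambda>n. (real n / 2 + a) powr (- Re s))"
    using a_pos by (subst powr_mult[symmetric]) (auto simp: field_simps)
  finally have summable:
    "summable (\<lambda>n. norm ((- 1 :: complex) ^ n) * (real n / 2 + a) powr (- Re s))"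
    by (simp add: norm_power)
  have "(\<lambda>n. (-1) ^ n * complex_of_real (exp (- ((real n / 2 + a) * x)))) sums
      eta_kernel a (of_real x)"
    if "x > 0" for x
  proof -
    have "(\<lambda>n. exp (- (a * x)) * (- exp (- (x / 2))) ^ n) sums
            (exp (- (a * x)) * (1 / (1 - (- exp (- (x / 2))))))"
      using that by (intro sums_mult geometric_sums) auto
    moreover have
      "exp (- (a * x)) * (- exp (- (x / 2))) ^ n = (-1) ^ n * exp (- ((real n / 2 + a) * x))" for n
      by (subst power_minus) (simp flip: exp_of_nat_mult exp_add add: algebra_simps)
    ultimately have "(\<lambda>n. (-1) ^ n * exp (- ((real n / 2 + a) * x))) sums
                       (exp (- (a * x)) / (1 + exp (- (x / 2))))"
      by simp
    from sums_of_real[OF this, where 'a = complex] show ?thesis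
      by (simp add: eta_kernel_def flip: exp_of_real)
  qed
  then have "(\<lambda>n. (-1) ^ n * of_real (real n / 2 + a) powr (- s)) sums
          (rGamma s * mellin (\<lambda>x. eta_kernel a (of_real x)) s)"
    using a_pos Re_s by (intro rGamma_mellin_exp_series summable) (auto simp: add_nonneg_pos)
  then show ?thesis
    using Re_s by (simp add: normalized_mellin_eq_mellin strip_decay_eta_kernel a_pos)
qed

lemma pochhammer_eq_stirling_sum:
  fixes x y :: "'a :: comm_ring_1"
  shows "pochhammer (y + 1 - x) m = (\<Sum>k\<le>m. (-1) ^ k * gen_stirling k m x * y ^ (m - k))"
proof -
  have "pochhammer (y + 1 - x) m = (\<Prod>i=1..m. poly [:of_nat i - x, 1:] y)"
    by (simp add: pochhammer_prod prod.atLeast1_atMost_eq atLeast0LessThan algebra_simps)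
  also have "\<dots> = poly (\<Prod>i=1..m. [:of_nat i - x, 1:]) y"
    by (rule poly_prod[symmetric])
  also have "\<dots> = (\<Sum>k\<le>m. (-1) ^ k * gen_stirling k m x * y ^ (m - k))"
    unfolding gen_stirling_identity by (simp add: poly_sum poly_monom)
  finally show ?thesis .
qed

lemma binomial_eq_stirling_sum:
  fixes x :: "'a :: field_char_0"
  shows "of_nat ((n + m) choose m) =
           (\<Sum>k\<le>m. (-1) ^ k * gen_stirling k m x * (of_nat n + x) ^ (m - k)) / fact m"
proof -
  have "of_nat ((n + m) choose m) = pochhammer (of_nat n + 1 :: 'a) m / fact m"
    by (simp add: binomial_gbinomial gbinomial_pochhammer')
  then show ?thesis
    using pochhammer_eq_stirling_sum[of "of_nat n + x" x m] by (simp add: algebra_simps)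
qed

lemma binomial_powr_eq_stirling_sum:
  fixes u x s :: complex
  assumes u_eq: "u \<noteq> 0" "2 * u = of_nat n + x"
  shows "of_nat ((n + m) choose m) * u powr (- s) =
           2 ^ m / fact m *
             (\<Sum>k\<le>m. (-1/2) ^ k * gen_stirling k m x * u powr (- (s + of_nat k - of_nat m)))"
proof -
  have summand: "(-1) ^ k * gen_stirling k m x * (2 * u) ^ (m - k) * u powr (- s) =
      2 ^ m *
        ((-1/2) ^ k * gen_stirling k m x * u powr (- (s + of_nat k - of_nat m)))" if "k \<le> m" for k
  proof -
    have "u powr (- (s + of_nat k - of_nat m)) = u powr (of_nat (m - k) + (- s))"
      using that by (simp add: of_nat_diff algebra_simps)
    also have "\<dots> = u ^ (m - k) * u powr (- s)"
      by (simp only: powr_add powr_complexpow[OF u_eq(1)])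
    finally have "u powr (- (s + of_nat k - of_nat m)) = u ^ (m - k) * u powr (- s)" .
    moreover have "(2::complex) ^ m * (-1/2) ^ k = 2 ^ (m - k) * (-1) ^ k"
    proof -
      have "(2::complex) ^ m = 2 ^ (m - k) * 2 ^ k"
        using that by (simp flip: power_add)
      moreover have "(2::complex) ^ k * (-1/2) ^ k = (-1) ^ k"
        by (simp flip: power_mult_distrib)
      ultimately show ?thesis
        by (simp only: mult.assoc)
    qed
    ultimately show ?thesis
      by (simp add: power_mult_distrib)
  qed
  have "of_nat ((n + m) choose m) * u powr (- s) =
      (\<Sum>k\<le>m. (-1) ^ k * gen_stirling k m x * (2 * u) ^ (m - k) * u powr (- s)) / fact m"
    unfolding binomial_eq_stirling_sum[of n m x] u_eq(2) by (simp add: sum_distrib_right)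
  also have "\<dots> = (\<Sum>k\<le>m. 2 ^ m * ((-1/2) ^ k * gen_stirling k m x *
                     u powr (- (s + of_nat k - of_nat m)))) / fact m"
    by (intro arg_cong2[of _ _ _ _ "(/)"] sum.cong summand) auto
  finally show ?thesis
    by (simp only: times_divide_eq_left flip: sum_distrib_left)
qed

lemma inverse_one_plus_power_sums:
  fixes z :: complex
  assumes norm_z: "norm z < 1"
  shows "(\<lambda>n. (-1) ^ n * of_nat ((n + m) choose m) * z ^ n) sums (inverse (1 + z) ^ Suc m)"
proof -
  have "(\<lambda>n. (-1) ^ n * (of_nat (Suc m) + of_nat n - 1 gchoose n) * z ^ n) sums
          (1 + z) powr (- of_nat (Suc m))"
    by (rule one_plus_neg_powr_powser[OF norm_z])
  moreover have
    "(of_nat (Suc m) + of_nat n - 1 gchoose n) = (of_nat ((n + m) choose m) :: complex)" for n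
  proof -
    have "(of_nat (Suc m) + of_nat n - 1 gchoose n) = (of_nat (n + m) gchoose n :: complex)"
      by (simp add: add_ac)
    also have "\<dots> = of_nat ((n + m) choose n)"
      by (rule binomial_gbinomial[symmetric])
    also have "(n + m) choose n = (n + m) choose m"
      using binomial_symmetric[of n "n + m"] by simp
    finally show ?thesis .
  qed
  moreover have "1 + z \<noteq> 0"
    using norm_z by (auto simp: add_eq_0_iff)
  then have "(1 + z) powr (- of_nat (Suc m)) = inverse (1 + z) ^ Suc m"
    by (simp add: powr_minus powr_complexpow power_inverse del: of_nat_Suc power_Suc)
  ultimately show ?thesis
    by simp
qed

lemma csech_pow_exp_series:
  assumes x_pos: "x > 0"
  shows "(\<lambda>n. 2 ^ Suc m * ((-1) ^ n * of_nat ((n + m) choose m)) *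
            of_real (exp (- ((2 * real n + real (Suc m)) * x)))) sums csech_pow (Suc m) (of_real x)"
proof -
  define z where "z = exp (- (2 * complex_of_real x))"
  define w where "w = 2 * exp (- complex_of_real x)"
  have "norm z < 1"
    using x_pos by (simp add: z_def)
  then have "(\<lambda>n. w ^ Suc m * ((-1) ^ n * of_nat ((n + m) choose m) * z ^ n)) sums
               (w ^ Suc m * inverse (1 + z) ^ Suc m)"
    by (intro sums_mult inverse_one_plus_power_sums)
  also have "w ^ Suc m * inverse (1 + z) ^ Suc m = (w * inverse (1 + z)) ^ Suc m"
    by (rule power_mult_distrib[symmetric])
  also have "w * inverse (1 + z) = inverse (cosh (of_real x))"
    by (simp add: cosh_eq_exp_times w_def z_def exp_minus inverse_eq_divide)
  also have "\<dots> ^ Suc m = csech_pow (Suc m) (of_real x)"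
    by (simp only: csech_pow_def)
  also have "(\<lambda>n. w ^ Suc m * ((-1) ^ n * of_nat ((n + m) choose m) * z ^ n)) =
      (\<lambda>n. 2 ^ Suc m * ((-1) ^ n * of_nat ((n + m) choose m)) *
            of_real (exp (- ((2 * real n + real (Suc m)) * x))))"
  proof
    fix n
    have exps:
      "exp (- complex_of_real x) ^ Suc m * z ^ n =
         of_real (exp (- ((2 * real n + real (Suc m)) * x)))"
      by (simp add: z_def algebra_simps del: power_Suc flip: exp_of_nat_mult exp_add exp_of_real)
    show "w ^ Suc m * ((-1) ^ n * of_nat ((n + m) choose m) * z ^ n) =
        2 ^ Suc m * ((-1) ^ n * of_nat ((n + m) choose m)) *
            of_real (exp (- ((2 * real n + real (Suc m)) * x)))"
      unfolding w_def power_mult_distrib exps[symmetric] by (simp only: mult_ac)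
  qed
  finally show ?thesis .
qed

lemma summable_binomial_powr:
  assumes \<sigma>_gt: "\<sigma> > real m + 1"
  shows "summable (\<lambda>n. real ((n + m) choose m) * (2 * real n + real (Suc m)) powr (- \<sigma>))"
proof (rule summable_comparison_test')
  show "summable (\<lambda>n. 2 powr (real m - \<sigma>) * (real n + real (Suc m) / 2) powr (- (\<sigma> - real m)))"
    using \<sigma>_gt by (intro summable_mult summable_shifted_powr) auto
  fix n :: nat
  define l where "l = 2 * real n + real (Suc m)"
  have l_eq: "l > 0" "l = 2 * (real n + real (Suc m) / 2)" by (simp_all add: l_def)
  have "real ((n + m) choose m) \<le> real ((n + m) ^ m)"
    by (simp only: of_nat_le_iff) (rule binomial_le_pow, simp)
  also have "\<dots> \<le> l ^ m"
    unfolding of_nat_power by (intro power_mono) (auto simp: l_def)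
  finally have "real ((n + m) choose m) * l powr (- \<sigma>) \<le> l ^ m * l powr (- \<sigma>)"
    by (rule mult_right_mono) simp
  also have "\<dots> = l powr (real m - \<sigma>)"
    using l_eq(1) by (simp add: powr_diff powr_minus powr_realpow field_simps)
  also have "\<dots> = 2 powr (real m - \<sigma>) * (real n + real (Suc m) / 2) powr (- (\<sigma> - real m))"
    unfolding l_eq(2) by (simp only: powr_mult minus_diff_eq)
  finally show "norm (real ((n + m) choose m) * (2 * real n + real (Suc m)) powr (- \<sigma>)) \<le>
      2 powr (real m - \<sigma>) * (real n + real (Suc m) / 2) powr (- (\<sigma> - real m))"
    by (simp add: l_def)
qed

lemma csech_pow_dirichlet_series:
  assumes Re_s: "Re s > real m + 1"
  shows "(\<lambda>n. 2 ^ Suc m * ((-1) ^ n * of_nat ((n + m) choose m)) *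
            of_real (2 * real n + real (Suc m)) powr (- s)) sums
         normalized_mellin (csech_pow (Suc m)) s"
proof -
  define c where "c = (\<lambda>n. 2 ^ Suc m * ((-1) ^ n * of_nat ((n + m) choose m)) :: complex)"
  have "summable (\<lambda>n. 2 ^ Suc m *
          (real ((n + m) choose m) * (2 * real n + real (Suc m)) powr (- Re s)))"
    using Re_s by (intro summable_mult summable_binomial_powr)
  then have "summable (\<lambda>n. norm (c n) * (2 * real n + real (Suc m)) powr (- Re s))"
    by (simp only: c_def norm_mult norm_power norm_minus_cancel norm_one power_one norm_numeral
        norm_of_nat mult_1_left mult.assoc)
  then have "(\<lambda>n. c n * of_real (2 * real n + real (Suc m)) powr (- s)) sums
      (rGamma s * mellin (\<lambda>x. csech_pow (Suc m) (of_real x)) s)"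
    using Re_s csech_pow_exp_series by (intro rGamma_mellin_exp_series) (auto simp: c_def)
  also have
    "rGamma s * mellin (\<lambda>x. csech_pow (Suc m) (of_real x)) s =
       normalized_mellin (csech_pow (Suc m)) s"
    using Re_s by (intro normalized_mellin_eq_mellin[symmetric] strip_decay_csech_pow) auto
  finally show ?thesis
    by (simp only: c_def)
qed

definition stirling_eta :: "nat \<Rightarrow> complex \<Rightarrow> complex" where
  "stirling_eta j s = (\<Sum>k=0..j-1. (-1/2) ^ k * gen_stirling k (j - 1) (of_nat j / 2) *
     normalized_mellin (eta_kernel (real j / 4)) (s + of_nat k - of_nat (j - 1)))"

lemma stirling_eta_sums:
  assumes Re_s: "Re s > real m + 1"
  shows
    "(\<lambda>n. (-1) ^ n * (of_nat ((n + m) choose m) *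
       of_real (real n / 2 + real (Suc m) / 4) powr (- s))) sums
           (2 ^ m / fact m * stirling_eta (Suc m) s)"
proof -
  define u where "u = (\<lambda>n. complex_of_real (real n / 2 + real (Suc m) / 4))"
  let ?P = "\<lambda>k. (-1/2) ^ k * gen_stirling k m (of_nat (Suc m) / 2) :: complex"
  have "(\<lambda>n. \<Sum>k=0..m. ?P k * ((-1) ^ n * u n powr (- (s + of_nat k - of_nat m)))) sums
      stirling_eta (Suc m) s"
    unfolding stirling_eta_def u_def diff_Suc_1 using Re_s
    by (intro sums_sum sums_mult eta_series_sums) auto
  then have
    "(\<lambda>n. 2 ^ m / fact m *
         (\<Sum>k=0..m. ?P k * ((-1) ^ n * u n powr (- (s + of_nat k - of_nat m))))) sums
      (2 ^ m / fact m * stirling_eta (Suc m) s)"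
    by (rule sums_mult)
  moreover have
    "2 ^ m / fact m * (\<Sum>k=0..m. ?P k * ((-1) ^ n * u n powr (- (s + of_nat k - of_nat m)))) =
      (-1) ^ n * (of_nat ((n + m) choose m) * u n powr (- s))" for n
  proof -
    have "u n \<noteq> 0"
      unfolding u_def of_real_eq_0_iff by (simp add: add_nonneg_eq_0_iff)
    moreover have "2 * u n = of_nat n + of_nat (Suc m) / 2"
      by (simp add: u_def)
    ultimately have "of_nat ((n + m) choose m) * u n powr (- s) =
        2 ^ m / fact m * (\<Sum>k\<le>m. ?P k * u n powr (- (s + of_nat k - of_nat m)))"
      by (rule binomial_powr_eq_stirling_sum)
    then show ?thesis
      by (simp add: atLeast0AtMost sum_distrib_left mult_ac)
  qed
  ultimately show ?thesis
    unfolding u_def by simp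
qed

lemma stirling_eta_holomorphic:
  assumes "j \<ge> 1"
  shows "stirling_eta j holomorphic_on A"
  unfolding stirling_eta_def[abs_def] using assms
  by (intro holomorphic_intros strip_decay_eta_kernel) auto

lemma normalized_mellin_csech_pow:
  assumes j_pos: "j \<ge> 1"
  shows
    "normalized_mellin (csech_pow j) s =
       2 ^ (2 * j - 1) / fact (j - 1) * 4 powr (- s) * stirling_eta j s"
proof -
  obtain m where j_eq: "j = Suc m" using j_pos by (cases j) auto
  have "normalized_mellin (csech_pow (Suc m)) =
      (\<lambda>s. 2 ^ Suc m * (4 powr (- s) * (2 ^ m / fact m * stirling_eta (Suc m) s)))"
  proof (rule entire_eqI_halfplane)
    fix s :: complex assume Re_s: "Re s > real m + 1"
    define u where "u = (\<lambda>n. complex_of_real (real n / 2 + real (Suc m) / 4))"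
    have "2 ^ Suc m * ((-1) ^ n * of_nat ((n + m) choose m)) *
            of_real (2 * real n + real (Suc m)) powr (- s) =
          2 ^ Suc m * (4 powr (- s) * ((-1) ^ n * (of_nat ((n + m) choose m) * u n powr (- s))))" for n
    proof -
      have "complex_of_real (2 * real n + real (Suc m)) = 4 * u n"
        by (simp add: u_def)
      also have "\<dots> powr (- s) = 4 powr (- s) * u n powr (- s)"
        unfolding u_def by (rule powr_times_real_left) auto
      finally show ?thesis
        by (simp only: mult_ac)
    qed
    then have "(\<lambda>n. 2 ^ Suc m * (4 powr (- s) *
                 ((-1) ^ n * (of_nat ((n + m) choose m) * u n powr (- s))))) sums
               normalized_mellin (csech_pow (Suc m)) s"
      using csech_pow_dirichlet_series[OF Re_s] by (simp only:)
    moreover have "(\<lambda>n. 2 ^ Suc m * (4 powr (- s) *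
                 ((-1) ^ n * (of_nat ((n + m) choose m) * u n powr (- s))))) sums
               (2 ^ Suc m * (4 powr (- s) * (2 ^ m / fact m * stirling_eta (Suc m) s)))"
      unfolding u_def by (intro sums_mult stirling_eta_sums Re_s)
    ultimately show "normalized_mellin (csech_pow (Suc m)) s =
        2 ^ Suc m * (4 powr (- s) * (2 ^ m / fact m * stirling_eta (Suc m) s))"
      by (rule sums_unique2)
  qed (auto intro!: holomorphic_intros normalized_mellin_holomorphic strip_decay_csech_pow
      stirling_eta_holomorphic)
  moreover have "2 * j - 1 = Suc m + m"
    using j_eq by simp
  ultimately show ?thesis
    by (simp only: j_eq power_add diff_Suc_1) (simp add: mult_ac)
qed

lemma stirling_eta_has_field_derivative:
  assumes j_pos: "j \<ge> 1"
  shows "(stirling_eta j has_field_derivative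
     (\<Sum>k=0..j-1. (-1/2) ^ k * gen_stirling k (j - 1) (of_nat j / 2) *
        zeta_bracket (of_nat k - of_nat j + 2) (real j / 4) ((real j + 2) / 4))) (at 1)"
proof -
  let ?N = "normalized_mellin (eta_kernel (real j / 4))"
  have "(?N has_field_derivative deriv ?N z) (at z)" for z
    using j_pos
    by (intro holomorphic_derivI[of _ UNIV] normalized_mellin_holomorphic strip_decay_eta_kernel)
        auto
  then have "((\<lambda>s. ?N (s + of_nat k - of_nat (j - 1))) has_field_derivative
      deriv ?N (1 + of_nat k - of_nat (j - 1)) * 1) (at 1)" for k
    by (intro DERIV_chain2[where f = ?N]) (auto intro!: derivative_eq_intros)
  then have "(stirling_eta j has_field_derivative
     (\<Sum>k=0..j-1. (-1/2) ^ k * gen_stirling k (j - 1) (of_nat j / 2) *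
        (deriv ?N (1 + of_nat k - of_nat (j - 1)) * 1))) (at 1)"
    unfolding stirling_eta_def by (intro DERIV_sum DERIV_cmult)
  moreover have "deriv ?N (1 + of_nat k - of_nat (j - 1)) =
      zeta_bracket (of_nat k - of_nat j + 2) (real j / 4) ((real j + 2) / 4)" for k
  proof -
    have "(1 + of_nat k - of_nat (j - 1) :: complex) = of_nat k - of_nat j + 2"
      using j_pos by (simp add: of_nat_diff)
    moreover have "(real j + 2) / 4 = real j / 4 + 1 / 2"
      by simp
    ultimately show ?thesis
      using j_pos by (simp only: zeta_bracket_half[of "real j / 4"])
  qed
  ultimately show ?thesis
    by simp
qed

lemma deriv_stirling_eta:
  "j \<ge> 1 \<Longrightarrow> deriv (stirling_eta j) 1 =
     (\<Sum>k=0..j-1. (-1/2) ^ k * gen_stirling k (j - 1) (of_nat j / 2) *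
        zeta_bracket (of_nat k - of_nat j + 2) (real j / 4) ((real j + 2) / 4))"
  by (rule DERIV_imp_deriv[OF stirling_eta_has_field_derivative])

subsection \<open>The integral of \<open>(sech x - sech\<^sup>j x) / x\<^sup>2\<close>\<close>

lemma fact_Suc_of_pos:
  assumes "j \<ge> 1"
  shows "(fact (j + 1) :: 'a :: semiring_char_0) = of_nat j * (of_nat j + 1) * fact (j - 1)"
  using assms by (cases j) (simp_all add: algebra_simps)

lemma normalized_mellin_csech_pow_shift_eq_stirling_eta:
  assumes j_pos: "j \<ge> 1" and Re_s: "Re s > 0"
  shows "4 powr s * normalized_mellin (csech_pow j) (s - 2) =
     2 ^ (2 * j - 1) * of_nat j ^ 2 / fact (j - 1) * stirling_eta j s
     - 2 ^ (2 * j + 3) / fact (j - 1) * stirling_eta (j + 2) s"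
proof -
  have "(of_nat j :: complex) \<noteq> 0" "(of_nat j + 1 :: complex) \<noteq> 0"
    using j_pos by (auto simp flip: of_nat_Suc simp: add.commute)
  then have coeff:
    "of_nat j * (of_nat j + 1) * (2 ^ (2 * j + 3) / fact (j + 1)) =
       (2 ^ (2 * j + 3) / fact (j - 1) :: complex)"
    using fact_Suc_of_pos[OF j_pos, where 'a = complex] by simp
  have times_normalized_mellin:
    "4 powr s * normalized_mellin (csech_pow i) s =
       2 ^ (2 * i - 1) / fact (i - 1) * stirling_eta i s"
    if "i \<ge> 1" for i
  proof -
    have "4 powr s * 4 powr (- s) = (1 :: complex)"
      by (simp flip: powr_add)
    then show ?thesis
      using normalized_mellin_csech_pow[OF that, of s] by (simp add: mult_ac)
  qed
  have times_normalized_mellin_shift: "4 powr s * normalized_mellin (csech_pow (j + 2)) s =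
      2 ^ (2 * j + 3) / fact (j + 1) * stirling_eta (j + 2) s"
  proof -
    have "2 * (j + 2) - 1 = 2 * j + 3" "j + 2 - 1 = j + 1"
      by simp_all
    then show ?thesis
      using times_normalized_mellin[of "j + 2"] by (simp only: le_add2 trans_le_add2 one_le_numeral)
  qed
  have "4 powr s * normalized_mellin (csech_pow j) (s - 2) =
      of_nat j ^ 2 * (4 powr s * normalized_mellin (csech_pow j) s)
      - of_nat j * (of_nat j + 1) * (4 powr s * normalized_mellin (csech_pow (j + 2)) s)"
    unfolding normalized_mellin_csech_pow_shift[OF j_pos Re_s]
    by (simp only: right_diff_distrib mult_ac)
  also have "\<dots> = of_nat j ^ 2 * (2 ^ (2 * j - 1) / fact (j - 1) * stirling_eta j s)
      - of_nat j * (of_nat j + 1) * (2 ^ (2 * j + 3) / fact (j + 1)) * stirling_eta (j + 2) s"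
    unfolding times_normalized_mellin[OF j_pos] times_normalized_mellin_shift
    by (simp only: mult.assoc)
  finally show ?thesis
    unfolding coeff by (simp add: mult_ac)
qed

lemma integral_one_minus_sech_pow_over_square:
  assumes j_pos: "j \<ge> 1"
  shows "4 * of_real (\<integral>x. (1 - sech x ^ j) / x\<^sup>2 \<partial>halfline) =
     2 ^ (2 * j - 1) * of_nat j ^ 2 / fact (j - 1) * deriv (stirling_eta j) 1
     - 2 ^ (2 * j + 3) / fact (j - 1) * deriv (stirling_eta (j + 2)) 1"
    (is "4 * ?I = ?c * _ - ?d * _")
proof -
  have "((\<lambda>s. ?c * stirling_eta j s - ?d * stirling_eta (j + 2) s) has_field_derivative
          ?c * deriv (stirling_eta j) 1 - ?d * deriv (stirling_eta (j + 2)) 1) (at 1)"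
    using j_pos
    by (intro DERIV_diff DERIV_cmult holomorphic_derivI[of _ UNIV] stirling_eta_holomorphic) auto
  then have "((\<lambda>s. 4 powr s * normalized_mellin (csech_pow j) (s - 2)) has_field_derivative
          ?c * deriv (stirling_eta j) 1 - ?d * deriv (stirling_eta (j + 2)) 1) (at 1)"
  proof (rule has_field_derivative_transform_within_open)
    show "?c * stirling_eta j s - ?d * stirling_eta (j + 2) s =
        4 powr s * normalized_mellin (csech_pow j) (s - 2)"
      if "s \<in> {s. Re s > 0}" for s
      using normalized_mellin_csech_pow_shift_eq_stirling_eta[OF j_pos, of s] that by simp
  qed (auto simp: open_halfspace_Re_gt)
  moreover have
    "((\<lambda>s. 4 powr s * normalized_mellin (csech_pow j) (s - 2)) has_field_derivative 4 * ?I) (at 1)"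
  proof -
    have shifted_mellin_deriv:
      "((\<lambda>s. normalized_mellin (csech_pow j) (s - 2)) has_field_derivative ?I * 1) (at 1)"
      using normalized_mellin_csech_pow_at_minus_1(3)[OF j_pos]
      by (intro DERIV_chain2[of "normalized_mellin (csech_pow j)"])
        (auto intro!: derivative_eq_intros)
    have "((\<lambda>s. 4 powr s) has_field_derivative 4 powr 1 * Ln 4) (at (1 :: complex))"
      by (auto simp: powr_def intro!: derivative_eq_intros)
    from DERIV_mult[OF this shifted_mellin_deriv] show ?thesis
      using normalized_mellin_csech_pow_at_minus_1(1)[OF j_pos] by (simp add: mult.commute)
  qed
  ultimately show ?thesis
    using DERIV_unique by blast
qed

lemma sech_F_eq_integral:
  assumes j_ge_2: "j \<ge> 2"
  shows "sech_F j = of_real ((\<integral>x. (1 - sech x ^ j) / x\<^sup>2 \<partial>halfline) - 4 * catalan_const / pi)"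
proof -
  have "2 * j - 1 = (2 * j - 3) + 2" "2 * j + 3 = (2 * j + 1) + 2"
    using j_ge_2 by simp_all
  then have "(2 :: complex) ^ (2 * j - 1) = 4 * 2 ^ (2 * j - 3)"
    "(2 :: complex) ^ (2 * j + 3) = 4 * 2 ^ (2 * j + 1)"
    by (simp_all only: power_add) simp_all
  then have "4 * complex_of_real (\<integral>x. (1 - sech x ^ j) / x\<^sup>2 \<partial>halfline) =
      4 * (2 ^ (2 * j - 3) * of_nat j ^ 2 / fact (j - 1) * deriv (stirling_eta j) 1
           - 2 ^ (2 * j + 1) / fact (j - 1) * deriv (stirling_eta (j + 2)) 1)"
    using integral_one_minus_sech_pow_over_square[of j] j_ge_2 by (simp add: algebra_simps)
  then have "complex_of_real (\<integral>x. (1 - sech x ^ j) / x\<^sup>2 \<partial>halfline) =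
      2 ^ (2 * j - 3) * of_nat j ^ 2 / fact (j - 1) * deriv (stirling_eta j) 1
      - 2 ^ (2 * j + 1) / fact (j - 1) * deriv (stirling_eta (j + 2)) 1"
    by (rule mult_left_cancel[THEN iffD1, rotated]) simp
  moreover have "deriv (stirling_eta (j + 2)) 1 =
      (\<Sum>m=0..j+1. (-1/2) ^ m * gen_stirling m (j + 1) ((of_nat j + 2) / 2) *
         zeta_bracket (of_nat m - of_nat j) ((real j + 2) / 4) ((real j + 4) / 4))"
    using deriv_stirling_eta[of "j + 2"] by (simp add: add_ac)
  ultimately show ?thesis
    using j_ge_2 deriv_stirling_eta[of j] by (simp add: sech_F_def)
qed

lemma has_bochner_integral_sech_diff_over_square:
  assumes j_pos: "j \<ge> 1"
  shows
    "has_bochner_integral halfline (\<lambda>x. complex_of_real ((sech x - sech x ^ j) / x\<^sup>2)) (sech_F j)"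
proof (cases "j = 1")
  case True
  then show ?thesis
    by (simp add: sech_F_def has_bochner_integral_zero)
next
  case False
  have "has_bochner_integral halfline (\<lambda>x. (1 - sech x ^ j) / x\<^sup>2 - (1 - sech x) / x\<^sup>2)
     ((\<integral>x. (1 - sech x ^ j) / x\<^sup>2 \<partial>halfline) - 4 * catalan_const / pi)"
    by (intro has_bochner_integral_diff has_bochner_integral_one_minus_sech_over_square
        has_bochner_integral_integrable normalized_mellin_csech_pow_at_minus_1(2) j_pos)
  then have "has_bochner_integral halfline (\<lambda>x. (sech x - sech x ^ j) / x\<^sup>2)
     ((\<integral>x. (1 - sech x ^ j) / x\<^sup>2 \<partial>halfline) - 4 * catalan_const / pi)"
    by (simp flip: diff_divide_distrib)
  then show ?thesis
    using sech_F_eq_integral[of j] j_pos False by (simp only: has_bochner_integral_of_real)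
qed

lemma has_bochner_integral_sech_combination:
  fixes w :: "nat \<Rightarrow> real"
  assumes "\<And>j. j \<in> J \<Longrightarrow> j \<ge> 1"
  shows "has_bochner_integral halfline
           (\<lambda>x. complex_of_real (((\<Sum>j\<in>J. w j) * sech x - (\<Sum>j\<in>J. w j * sech x ^ j)) / x\<^sup>2))
           (\<Sum>j\<in>J. of_real (w j) * sech_F j)"
proof -
  have "has_bochner_integral halfline
          (\<lambda>x. \<Sum>j\<in>J. of_real (w j) * complex_of_real ((sech x - sech x ^ j) / x\<^sup>2))
          (\<Sum>j\<in>J. of_real (w j) * sech_F j)"
    using assms
    by (intro has_bochner_integral_sum has_bochner_integral_mult_right
        has_bochner_integral_sech_diff_over_square)
  moreover have "(\<Sum>j\<in>J. of_real (w j) * complex_of_real ((sech x - sech x ^ j) / x\<^sup>2)) =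
        complex_of_real (((\<Sum>j\<in>J. w j) * sech x - (\<Sum>j\<in>J. w j * sech x ^ j)) / x\<^sup>2)" for x
    by (simp add: right_diff_distrib sum_subtractf sum_distrib_right flip: sum_divide_distrib)
  ultimately show ?thesis by simp
qed

subsection \<open>Sums of ballot numbers\<close>

lemma sum_ballot_binomials:
  assumes "1 \<le> m" "m \<le> N"
  shows "(\<Sum>j=m..N. (2 * N - j - 1) choose (N - j)) = (2 * N - m) choose (N - m)"
proof -
  have "(\<Sum>j=m..N. (2 * N - j - 1) choose (N - j)) = (\<Sum>k\<le>N-m. (N - 1 + k) choose k)"
    by (rule sum.reindex_bij_witness[of _ "\<lambda>k. N - k" "\<lambda>j. N - j"])
      (use assms in \<open>auto simp: mult_2\<close>)
  also have "\<dots> = Suc (N - 1 + (N - m)) choose (N - m)"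
    by (rule sum_choose_lower)
  also have "Suc (N - 1 + (N - m)) = 2 * N - m"
    using assms by simp
  finally show ?thesis .
qed

lemma sum_times_ballot_binomials:
  assumes N_pos: "N \<ge> 1"
  shows "(\<Sum>j=1..N. j * ((2 * N - j - 1) choose (N - 1))) = (2 * N) choose (N - 1)"
proof -
  have "j * ((2 * N - j - 1) choose (N - 1)) = (\<Sum>m=1..j. (2 * N - j - 1) choose (N - j))"
    if "j \<in> {1..N}" for j
    using binomial_symmetric[of "N - j" "2 * N - j - 1"] that by simp
  then have "(\<Sum>j=1..N. j * ((2 * N - j - 1) choose (N - 1))) =
        (\<Sum>j=1..N. \<Sum>m=1..j. (2 * N - j - 1) choose (N - j))"
    by (rule sum.cong[OF refl])
  also have "\<dots> = (\<Sum>m=1..N. \<Sum>j=m..N. (2 * N - j - 1) choose (N - j))"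
    by (subst sum.Sigma, simp, simp, subst sum.Sigma, simp, simp)
       (rule sum.reindex_bij_witness[of _ "\<lambda>(m, j). (j, m)" "\<lambda>(j, m). (m, j)"]; auto)
  also have "\<dots> = (\<Sum>m=1..N. (2 * N - m) choose (N - m))"
    by (intro sum.cong sum_ballot_binomials) auto
  also have "\<dots> = (\<Sum>k\<le>N-1. (N + k) choose k)"
    by (rule sum.reindex_bij_witness[of _ "\<lambda>k. N - k" "\<lambda>j. N - j"])
      (use N_pos in \<open>auto simp: mult_2\<close>)
  also have "\<dots> = Suc (N + (N - 1)) choose (N - 1)"
    by (rule sum_choose_lower)
  also have "Suc (N + (N - 1)) = 2 * N" using N_pos by simp
  finally show ?thesis .
qed

lemma times_central_binomial:
  assumes N_pos: "N \<ge> 1"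
  shows "N * ((2 * N) choose N) = (N + 1) * ((2 * N) choose (N - 1))"
proof -
  have "N * ((2 * N) choose N) = 2 * N * ((2 * N - 1) choose (N - 1))"
    using N_pos by (intro times_binomial_minus1_eq) auto
  also have "\<dots> = (2 * N - (N - 1)) * ((2 * N) choose (N - 1))"
    by (rule binomial_absorb_comp[symmetric])
  also have "2 * N - (N - 1) = N + 1" using N_pos by simp
  finally show ?thesis .
qed

lemma sum_weighted_ballot_binomials:
  assumes N_pos: "N \<ge> 1"
  shows "(\<Sum>j=1..N. real j / real N * real ((2 * N - j - 1) choose (N - 1))) =
           1 / (real N + 1) * real ((2 * N) choose N)"
proof -
  have "real N * real ((2 * N) choose N) = (real N + 1) * real ((2 * N) choose (N - 1))"
    using arg_cong[OF times_central_binomial[OF N_pos], of real]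
    by (simp only: of_nat_mult of_nat_add of_nat_1)
  then have "real ((2 * N) choose (N - 1)) / real N = 1 / (real N + 1) * real ((2 * N) choose N)"
    using N_pos by (simp add: field_simps)
  moreover have "(\<Sum>j=1..N. real j / real N * real ((2 * N - j - 1) choose (N - 1))) =
        real (\<Sum>j=1..N. j * ((2 * N - j - 1) choose (N - 1))) / real N"
    by (simp add: sum_divide_distrib)
  ultimately show ?thesis
    by (simp only: sum_times_ballot_binomials[OF N_pos])
qed

theorem theorem1:
  fixes N :: nat
  assumes "N \<ge> 1"
  shows "(\<forall>m\<in>{1..N}.
           has_bochner_integral (restrict_space lborel {0<..})
             (\<lambda>x::real. complex_of_real
                ((real ((2 * N - m) choose (N - m)) * sech x
                  - (\<Sum>j=m..N. real ((2 * N - j - 1) choose (N - j)) * sech x ^ j)) / x\<^sup>2))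
             (\<Sum>j=m..N. of_nat ((2 * N - j - 1) choose (N - j)) * sech_F j))
       \<and> has_bochner_integral (restrict_space lborel {0<..})
             (\<lambda>x::real. complex_of_real
                ((1 / (real N + 1) * real ((2 * N) choose N) * sech x
                  - (\<Sum>j=1..N. real j / real N * real ((2 * N - j - 1) choose (N - 1)) * sech x ^ j)) / x\<^sup>2))
             (\<Sum>j=1..N. of_nat j / of_nat N * of_nat ((2 * N - j - 1) choose (N - 1)) * sech_F j)"
  (is "(\<forall>m\<in>{1..N}. ?i m) \<and> ?ii")
proof (intro conjI ballI)
  fix m assume m_range: "m \<in> {1..N}"
  then have "real ((2 * N - m) choose (N - m)) = (\<Sum>j=m..N. real ((2 * N - j - 1) choose (N - j)))"
    by (simp only: sum_ballot_binomials[symmetric] atLeastAtMost_iff of_nat_sum)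
  then show "?i m"
    using has_bochner_integral_sech_combination[of "{m..N}"
        "\<lambda>j. real ((2 * N - j - 1) choose (N - j))"] m_range
    by simp
next
  show ?ii
    using has_bochner_integral_sech_combination[of "{1..N}"
        "\<lambda>j. real j / real N * real ((2 * N - j - 1) choose (N - 1))"]
    unfolding sum_weighted_ballot_binomials[OF assms] by simp
qed

end
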